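(* Let $\Gamma$ be a group containing a non-abelian free subgroup. Then $\Gamma$ is not strongly Ulam stable; in fact $F_\Gamma(\delta) \ge \frac{\sqrt{3}}{16}$ for every $\delta > 0$.
   Context: For a Hilbert space $\mathcal H$, $U(\mathcal H)$ is its unitary group and $\|\cdot\|$ the operator norm. For maps $\mu,\nu:\Gamma\to U(\mathcal H)$ put $\|\mu-\nu\|=\sup_{\gamma\in\Gamma}\|\mu(\gamma)-\nu(\gamma)\|$. Define $D(\mu)=\inf\{\|\mu-\nu\| : \nu\in \mathrm{Hom}(\Gamma,U(\mathcal H))\}$ and the defect $\mathrm{def}(\mu)=\sup_{x,y\in\Gamma}\|\mu(xy)-\mu(x)\mu(y)\|$. For $\delta\ge 0$, $F_\Gamma(\delta)=\sup\{D(\mu): \mathrm{def}(\mu)\le\delta,\ \mu(e)=\mathrm{Id}\}$, the supremum over all Hilbert spaces $\mathcal H$ and all maps $\mu:\Gamma\to U(\mathcal H)$ with $\mu(e)=\mathrm{Id}$. Put $\mathrm{def}(\Gamma)=\lim_{\delta\to0^+}F_\Gamma(\delta)$. $\Gamma$ is strongly Ulam stable if $\mathrm{def}(\Gamma)=0$. *)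

theory Defs
  imports "HOL-Analysis.Analysis" "HOL-Algebra.Generated_Groups"
begin

fun word_eval :: "('g, 'b) monoid_scheme \<Rightarrow> ('g \<times> bool) list \<Rightarrow> 'g" where
  "word_eval G [] = \<one>\<^bsub>G\<^esub>"
| "word_eval G ((s, b) # w) =
     (if b then s else inv\<^bsub>G\<^esub> s) \<otimes>\<^bsub>G\<^esub> word_eval G w"

fun reduced_word :: "('g \<times> bool) list \<Rightarrow> bool" where
  "reduced_word ((s, b) # (t, c) # w) =
     (\<not> (s = t \<and> b \<noteq> c) \<and> reduced_word ((t, c) # w))"
| "reduced_word _ = True"

definition free_basis :: "('g, 'b) monoid_scheme \<Rightarrow> 'g set \<Rightarrow> bool" where
  "free_basis G S \<longleftrightarrow> S \<subseteq> carrier G \<and>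
     (\<forall>w. w \<noteq> [] \<and> fst ` set w \<subseteq> S \<and> reduced_word w \<longrightarrow> word_eval G w \<noteq> \<one>\<^bsub>G\<^esub>)"

definition free_subgroup :: "('g, 'b) monoid_scheme \<Rightarrow> 'g set \<Rightarrow> bool" where
  "free_subgroup G H \<longleftrightarrow> subgroup H G \<and> (\<exists>S. free_basis G S \<and> generate G S = H)"

definition has_nonabelian_free_subgroup :: "('g, 'b) monoid_scheme \<Rightarrow> bool" where
  "has_nonabelian_free_subgroup G \<longleftrightarrow>
     (\<exists>H. free_subgroup G H \<and> \<not> (\<forall>x\<in>H. \<forall>y\<in>H. x \<otimes>\<^bsub>G\<^esub> y = y \<otimes>\<^bsub>G\<^esub> x))"

text \<open>Every complex Hilbert space is unitarily isomorphic to l2(I) for an index set I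
  (an orthonormal basis); all notions below are invariant under unitary isomorphism.\<close>

definition l2 :: "'i set \<Rightarrow> ('i \<Rightarrow> complex) set" where
  "l2 I = {x. (\<forall>i. i \<notin> I \<longrightarrow> x i = 0) \<and> (\<lambda>i. (cmod (x i))\<^sup>2) summable_on I}"

definition l2norm :: "'i set \<Rightarrow> ('i \<Rightarrow> complex) \<Rightarrow> real" where
  "l2norm I x = sqrt (infsum (\<lambda>i. (cmod (x i))\<^sup>2) I)"

definition opnorm :: "'i set \<Rightarrow> (('i \<Rightarrow> complex) \<Rightarrow> ('i \<Rightarrow> complex)) \<Rightarrow> real" where
  "opnorm I T = (SUP x \<in> {x \<in> l2 I. l2norm I x \<le> 1}. l2norm I (T x))"

definition unitary_op :: "'i set \<Rightarrow> (('i \<Rightarrow> complex) \<Rightarrow> ('i \<Rightarrow> complex)) \<Rightarrow> bool" where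
  "unitary_op I U \<longleftrightarrow>
     (\<forall>x\<in>l2 I. U x \<in> l2 I) \<and> (\<forall>y\<in>l2 I. \<exists>x\<in>l2 I. U x = y) \<and>
     (\<forall>x\<in>l2 I. l2norm I (U x) = l2norm I x) \<and>
     (\<forall>x\<in>l2 I. \<forall>y\<in>l2 I. \<forall>c::complex.
        U (\<lambda>i. c * x i + y i) = (\<lambda>i. c * U x i + U y i))"

definition unitary_map :: "('g, 'b) monoid_scheme \<Rightarrow> 'i set \<Rightarrow>
    ('g \<Rightarrow> ('i \<Rightarrow> complex) \<Rightarrow> ('i \<Rightarrow> complex)) \<Rightarrow> bool" where
  "unitary_map G I \<mu> \<longleftrightarrow> (\<forall>g\<in>carrier G. unitary_op I (\<mu> g))"

definition unitary_hom :: "('g, 'b) monoid_scheme \<Rightarrow> 'i set \<Rightarrow>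
    ('g \<Rightarrow> ('i \<Rightarrow> complex) \<Rightarrow> ('i \<Rightarrow> complex)) \<Rightarrow> bool" where
  "unitary_hom G I \<nu> \<longleftrightarrow> unitary_map G I \<nu> \<and>
     (\<forall>x\<in>carrier G. \<forall>y\<in>carrier G. \<forall>v\<in>l2 I. \<nu> (x \<otimes>\<^bsub>G\<^esub> y) v = \<nu> x (\<nu> y v))"

definition map_dist :: "('g, 'b) monoid_scheme \<Rightarrow> 'i set \<Rightarrow>
    ('g \<Rightarrow> ('i \<Rightarrow> complex) \<Rightarrow> ('i \<Rightarrow> complex)) \<Rightarrow>
    ('g \<Rightarrow> ('i \<Rightarrow> complex) \<Rightarrow> ('i \<Rightarrow> complex)) \<Rightarrow> real" where
  "map_dist G I \<mu> \<nu> = (SUP g \<in> carrier G. opnorm I (\<lambda>v. \<mu> g v - \<nu> g v))"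

definition dist_hom :: "('g, 'b) monoid_scheme \<Rightarrow> 'i set \<Rightarrow>
    ('g \<Rightarrow> ('i \<Rightarrow> complex) \<Rightarrow> ('i \<Rightarrow> complex)) \<Rightarrow> real" where
  "dist_hom G I \<mu> = (INF \<nu> \<in> {\<nu>. unitary_hom G I \<nu>}. map_dist G I \<mu> \<nu>)"

definition defect :: "('g, 'b) monoid_scheme \<Rightarrow> 'i set \<Rightarrow>
    ('g \<Rightarrow> ('i \<Rightarrow> complex) \<Rightarrow> ('i \<Rightarrow> complex)) \<Rightarrow> real" where
  "defect G I \<mu> = (SUP p \<in> carrier G \<times> carrier G.
      opnorm I (\<lambda>v. \<mu> (fst p \<otimes>\<^bsub>G\<^esub> snd p) v - \<mu> (fst p) (\<mu> (snd p) v)))"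

text \<open>F_Gamma(delta), where the Hilbert spaces range over l2(I) with I a subset of the
  index type 'i.\<close>
definition F_Ulam :: "('g, 'b) monoid_scheme \<Rightarrow> 'i itself \<Rightarrow> real \<Rightarrow> real" where
  "F_Ulam G _ \<delta> = (SUP p \<in> {(I :: 'i set, \<mu>). unitary_map G I \<mu> \<and>
        (\<forall>v\<in>l2 I. \<mu> \<one>\<^bsub>G\<^esub> v = v) \<and> defect G I \<mu> \<le> \<delta>}.
      dist_hom G (fst p) (snd p))"

definition def_group :: "('g, 'b) monoid_scheme \<Rightarrow> 'i itself \<Rightarrow> real" where
  "def_group G t = Lim (at_right 0) (F_Ulam G t)"

definition strongly_Ulam_stable :: "('g, 'b) monoid_scheme \<Rightarrow> 'i itself \<Rightarrow> bool" where
  "strongly_Ulam_stable G t \<longleftrightarrow> def_group G t = 0"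

end

theory Submission
  imports Defs
begin

text \<open>
  Let \<open>a\<close>, \<open>b\<close> be part of a free basis, \<open>H\<close> the subgroup they generate and \<open>\<phi>\<close> the Brooks
  quasimorphism on \<open>H\<close> counting occurrences of \<open>ab\<close>. It vanishes on the powers of \<open>a\<close> and of \<open>b\<close>,
  but \<open>\<phi> ((ab)\<^sup>n) = n\<close>. For large \<open>M\<close> the function \<open>\<theta> = exp (i\<pi>\<phi>/M)\<close> is almost a character
  of \<open>H\<close>, and it induces an almost representation \<open>\<mu>\<close> of \<open>G\<close> with the same defect, having a unit
  vector \<open>\<xi>\<close> with \<open>\<mu>(h) \<xi> = \<theta>(h) \<xi>\<close> for \<open>h \<in> H\<close>.

  If a representation \<open>\<nu>\<close> were within \<open>1/8\<close> of \<open>\<mu>\<close>, the \<open>H\<close>-orbit of the line of \<open>\<xi>\<close> would have small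
  diameter in projective space. Strict convexity of small balls gives it an essentially unique
  centre, hence lines that are invariant under \<open>H\<close> up to an arbitrarily small error. On such a line
  \<open>H\<close> acts almost by a character close to \<open>\<theta>\<close>. This character takes values close to \<open>1\<close> on all powers
  of \<open>a\<close> and \<open>b\<close>, so it is trivial, whereas \<open>\<theta> ((ab)\<^sup>M) = -1\<close>.
\<close>

section \<open>The Hilbert space of square-summable functions\<close>

definition l2ip :: "'i set \<Rightarrow> ('i \<Rightarrow> complex) \<Rightarrow> ('i \<Rightarrow> complex) \<Rightarrow> complex" where
  "l2ip I x y = infsum (\<lambda>i. x i * cnj (y i)) I"

lemma l2_summable_mult_cnj:
  assumes "x \<in> l2 I" "y \<in> l2 I"
  shows "(\<lambda>i. x i * cnj (y i)) summable_on I"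
proof -
  have "(\<lambda>i. (cmod (x i))\<^sup>2 + (cmod (y i))\<^sup>2) summable_on I"
    using assms by (intro summable_on_add) (auto simp: l2_def)
  then have "(\<lambda>i. norm (x i * cnj (y i))) summable_on I"
  proof (rule summable_on_comparison_test)
    fix i
    have "0 \<le> (cmod (x i) - cmod (y i))\<^sup>2 + (cmod (x i))\<^sup>2 + (cmod (y i))\<^sup>2" by simp
    then show "norm (x i * cnj (y i)) \<le> (cmod (x i))\<^sup>2 + (cmod (y i))\<^sup>2"
      by (simp add: norm_mult power2_eq_square algebra_simps)
  qed simp
  then show ?thesis by (rule abs_summable_summable)
qed

lemma l2_lincomb:
  assumes "x \<in> l2 I" "y \<in> l2 I"
  shows "(\<lambda>i. c * x i + y i) \<in> l2 I"
proof -
  have "(\<lambda>i. (2 * (cmod c)\<^sup>2) * (cmod (x i))\<^sup>2 + 2 * (cmod (y i))\<^sup>2) summable_on I"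
    using assms by (intro summable_on_add summable_on_cmult_right) (auto simp: l2_def)
  then have "(\<lambda>i. (cmod (c * x i + y i))\<^sup>2) summable_on I"
  proof (rule summable_on_comparison_test)
    fix i
    have "(cmod (c * x i + y i))\<^sup>2 \<le> (cmod c * cmod (x i) + cmod (y i))\<^sup>2"
      by (rule power_mono) (use norm_triangle_ineq[of "c * x i" "y i"] in \<open>simp_all add: norm_mult\<close>)
    also have "\<dots> \<le> (2 * (cmod c)\<^sup>2) * (cmod (x i))\<^sup>2 + 2 * (cmod (y i))\<^sup>2"
      using zero_le_power2[of "cmod c * cmod (x i) - cmod (y i)"]
      by (simp add: power2_eq_square algebra_simps)
    finally show "(cmod (c * x i + y i))\<^sup>2 \<le> (2 * (cmod c)\<^sup>2) * (cmod (x i))\<^sup>2 + 2 * (cmod (y i))\<^sup>2" .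
  qed simp
  then show ?thesis using assms by (auto simp: l2_def)
qed

lemma l2_zero: "(\<lambda>i. 0) \<in> l2 I"
  by (simp add: l2_def)

lemma l2_scale: "x \<in> l2 I \<Longrightarrow> (\<lambda>i. c * x i) \<in> l2 I"
  using l2_lincomb[OF _ l2_zero, of x I c] by simp

lemma l2_diff:
  assumes "x \<in> l2 I" "y \<in> l2 I" shows "x - y \<in> l2 I"
  using l2_lincomb[of y I x "-1"] assms by (simp add: fun_diff_def)

lemma l2norm_zero: "l2norm I (\<lambda>i. 0) = 0"
  by (simp add: l2norm_def)

lemma l2norm_nonneg: "l2norm I x \<ge> 0"
  by (simp add: l2norm_def infsum_nonneg)

lemma l2ip_lincomb_left:
  assumes "x \<in> l2 I" "y \<in> l2 I" "z \<in> l2 I"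
  shows "l2ip I (\<lambda>i. c * x i + y i) z = c * l2ip I x z + l2ip I y z"
proof -
  have "l2ip I (\<lambda>i. c * x i + y i) z = infsum (\<lambda>i. c * (x i * cnj (z i)) + y i * cnj (z i)) I"
    unfolding l2ip_def by (rule infsum_cong) (simp add: algebra_simps)
  also have "\<dots> = infsum (\<lambda>i. c * (x i * cnj (z i))) I + infsum (\<lambda>i. y i * cnj (z i)) I"
    using assms by (intro infsum_add summable_on_cmult_right l2_summable_mult_cnj)
  also have "\<dots> = c * l2ip I x z + l2ip I y z"
    unfolding l2ip_def by (subst infsum_cmult_right) (use assms in \<open>auto intro: l2_summable_mult_cnj\<close>)
  finally show ?thesis .
qed

lemma l2ip_commute: "l2ip I y x = cnj (l2ip I x y)"
  unfolding l2ip_def by (subst infsum_cnj[symmetric]) (simp add: mult.commute)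

lemma l2ip_lincomb_right:
  assumes "x \<in> l2 I" "y \<in> l2 I" "z \<in> l2 I"
  shows "l2ip I z (\<lambda>i. c * x i + y i) = cnj c * l2ip I z x + l2ip I z y"
  using l2ip_lincomb_left[OF assms, of c] l2ip_commute
  by (metis complex_cnj_add complex_cnj_cnj complex_cnj_mult)

lemma l2ip_scale_left:
  assumes "x \<in> l2 I" "z \<in> l2 I"
  shows "l2ip I (\<lambda>i. c * x i) z = c * l2ip I x z"
  using l2ip_lincomb_left[OF assms(1) l2_zero assms(2), of c] by (simp add: l2ip_def)

lemma l2ip_scale_right:
  assumes "x \<in> l2 I" "z \<in> l2 I"
  shows "l2ip I z (\<lambda>i. c * x i) = cnj c * l2ip I z x"
  using l2ip_lincomb_right[OF assms(1) l2_zero assms(2), of c] by (simp add: l2ip_def)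

lemma l2ip_self:
  assumes "x \<in> l2 I"
  shows "l2ip I x x = of_real ((l2norm I x)\<^sup>2)"
proof -
  have "l2ip I x x = infsum (\<lambda>i. complex_of_real ((cmod (x i))\<^sup>2)) I"
    unfolding l2ip_def by (rule infsum_cong) (metis complex_norm_square)
  also have "\<dots> = of_real (infsum (\<lambda>i. (cmod (x i))\<^sup>2) I)"
    using assms by (intro infsumI has_sum_of_real has_sum_infsum) (simp add: l2_def)
  finally show ?thesis by (simp add: l2norm_def infsum_nonneg)
qed

lemma l2norm_lincomb_sq:
  assumes "x \<in> l2 I" "y \<in> l2 I"
  shows "(l2norm I (\<lambda>i. c * x i + y i))\<^sup>2 =
    (cmod c)\<^sup>2 * (l2norm I x)\<^sup>2 + 2 * Re (c * l2ip I x y) + (l2norm I y)\<^sup>2"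
proof -
  have "complex_of_real ((l2norm I (\<lambda>i. c * x i + y i))\<^sup>2) =
      c * cnj c * of_real ((l2norm I x)\<^sup>2) + (c * l2ip I x y + cnj (c * l2ip I x y)) + of_real ((l2norm I y)\<^sup>2)"
    unfolding l2ip_self[OF assms(1), symmetric] l2ip_self[OF assms(2), symmetric]
      l2ip_self[OF l2_lincomb[OF assms], symmetric] l2ip_lincomb_left[OF assms l2_lincomb[OF assms]]
      l2ip_lincomb_right[OF assms assms(1)] l2ip_lincomb_right[OF assms assms(2)] l2ip_commute[of I y x]
    by (simp add: algebra_simps)
  also have "\<dots> = of_real ((cmod c)\<^sup>2 * (l2norm I x)\<^sup>2 + 2 * Re (c * l2ip I x y) + (l2norm I y)\<^sup>2)"
    by (simp only: complex_norm_square[symmetric] complex_add_cnj of_real_add of_real_mult of_real_power)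
  finally show ?thesis by (simp only: of_real_eq_iff)
qed

lemma l2norm_scale:
  assumes "x \<in> l2 I"
  shows "l2norm I (\<lambda>i. c * x i) = cmod c * l2norm I x"
proof -
  have "(l2norm I (\<lambda>i. c * x i))\<^sup>2 = (cmod c * l2norm I x)\<^sup>2"
    using l2norm_lincomb_sq[OF assms l2_zero, of c]
    by (simp add: l2norm_zero l2ip_def power_mult_distrib)
  then show ?thesis by (simp add: l2norm_nonneg)
qed

text \<open>The discriminant criterion behind Cauchy-Schwarz, where \<open>p\<close> will be the
  squared modulus of an inner product and \<open>a\<close>, \<open>b\<close> squared norms. The
  parabola has its minimum at \<open>- 1 / a\<close>; for \<open>a = 0\<close> it is affine in
  \<open>r\<close>, so a nonzero slope would make it negative somewhere.\<close>

lemma quadratic_nonneg_bound: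
  fixes p a b :: real
  assumes "p \<ge> 0" "a \<ge> 0" "\<And>r. 0 \<le> r\<^sup>2 * p * a + 2 * r * p + b"
  shows "p \<le> a * b"
proof (cases "a = 0 \<or> p = 0")
  case True
  have "b \<ge> 0" using assms(3)[of 0] by simp
  moreover have False if "a = 0" "p > 0"
    using assms(3)[of "- (b + 1) / p"] that \<open>b \<ge> 0\<close> by simp
  ultimately show ?thesis using True assms(1,2) by fastforce
next
  case False
  have "(- 1 / a)\<^sup>2 * p * a + 2 * (- 1 / a) * p + b = b - p / a"
    using False by (simp add: field_simps power2_eq_square)
  with assms(3)[of "- 1 / a"] have "p / a \<le> b" by simp
  then show ?thesis using False assms(2) by (simp add: field_simps)
qed

lemma l2_Cauchy_Schwarz:
  assumes "x \<in> l2 I" "y \<in> l2 I"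
  shows "cmod (l2ip I x y) \<le> l2norm I x * l2norm I y"
proof -
  let ?p = "l2ip I x y" and ?a = "(l2norm I x)\<^sup>2" and ?b = "(l2norm I y)\<^sup>2"
  have D: "0 \<le> r\<^sup>2 * (cmod ?p)\<^sup>2 * ?a + 2 * r * (cmod ?p)\<^sup>2 + ?b" for r :: real
  proof -
    have "0 \<le> (l2norm I (\<lambda>i. (of_real r * cnj ?p) * x i + y i))\<^sup>2" by simp
    also have "\<dots> = (cmod (of_real r * cnj ?p))\<^sup>2 * ?a + 2 * Re (of_real r * (?p * cnj ?p)) + ?b"
      by (subst l2norm_lincomb_sq[OF assms]) (simp add: algebra_simps)
    finally show ?thesis
      unfolding complex_norm_square[symmetric] by (simp add: norm_mult power_mult_distrib)
  qed
  have "(cmod ?p)\<^sup>2 \<le> ?a * ?b"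
    by (rule quadratic_nonneg_bound[OF _ _ D]) simp_all
  then show ?thesis
    by (metis l2norm_nonneg mult_nonneg_nonneg power2_le_imp_le power_mult_distrib)
qed

lemma l2norm_lincomb_le:
  assumes "x \<in> l2 I" "y \<in> l2 I"
  shows "l2norm I (\<lambda>i. c * x i + y i) \<le> cmod c * l2norm I x + l2norm I y"
proof (rule power2_le_imp_le)
  have "Re (c * l2ip I x y) \<le> cmod c * cmod (l2ip I x y)"
    by (metis complex_Re_le_cmod norm_mult)
  also have "\<dots> \<le> cmod c * (l2norm I x * l2norm I y)"
    by (intro mult_left_mono l2_Cauchy_Schwarz assms) simp
  finally show "(l2norm I (\<lambda>i. c * x i + y i))\<^sup>2 \<le> (cmod c * l2norm I x + l2norm I y)\<^sup>2"
    by (subst l2norm_lincomb_sq[OF assms]) (simp add: power2_eq_square algebra_simps)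
qed (simp add: l2norm_nonneg)

lemma l2norm_diff_le:
  assumes "x \<in> l2 I" "y \<in> l2 I"
  shows "l2norm I (x - y) \<le> l2norm I x + l2norm I y"
  using l2norm_lincomb_le[OF assms(2,1), of "-1"] by (simp add: fun_diff_def)

lemma l2norm_diff_triangle:
  assumes "x \<in> l2 I" "y \<in> l2 I" "z \<in> l2 I"
  shows "l2norm I (x - z) \<le> l2norm I (x - y) + l2norm I (y - z)"
  using l2norm_lincomb_le[OF l2_diff[OF assms(1,2)] l2_diff[OF assms(2,3)], of 1]
  by (simp add: fun_diff_def)

lemma l2ip_diff_left:
  assumes "x \<in> l2 I" "y \<in> l2 I" "z \<in> l2 I"
  shows "l2ip I (x - y) z = l2ip I x z - l2ip I y z"
  using l2ip_lincomb_left[OF assms(2,1,3), of "-1"] by (simp add: fun_diff_def)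

lemma l2ip_diff_right:
  assumes "x \<in> l2 I" "y \<in> l2 I" "z \<in> l2 I"
  shows "l2ip I z (x - y) = l2ip I z x - l2ip I z y"
  using l2ip_lincomb_right[OF assms(2,1,3), of "-1"] by (simp add: fun_diff_def)

text \<open>Polarisation: comparing the norms of \<open>c * x + y\<close> before and after
  \<open>U\<close> isolates the real part of \<open>c\<close> times the inner product. Taking
  \<open>c\<close> to be 1 and the imaginary unit recovers both parts.\<close>

lemma unitary_op_ip:
  assumes U: "unitary_op I U" and "x \<in> l2 I" "y \<in> l2 I"
  shows "l2ip I (U x) (U y) = l2ip I x y"
proof -
  have Ux: "U x \<in> l2 I" "U y \<in> l2 I" using assms by (auto simp: unitary_op_def)
  have *: "Re (c * l2ip I (U x) (U y)) = Re (c * l2ip I x y)" for c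
  proof -
    have "(l2norm I (U (\<lambda>i. c * x i + y i)))\<^sup>2 = (l2norm I (\<lambda>i. c * x i + y i))\<^sup>2"
      using assms l2_lincomb by (metis unitary_op_def)
    moreover have "U (\<lambda>i. c * x i + y i) = (\<lambda>i. c * U x i + U y i)"
      using assms by (auto simp: unitary_op_def)
    moreover have "l2norm I (U x) = l2norm I x" "l2norm I (U y) = l2norm I y"
      using assms by (auto simp: unitary_op_def)
    ultimately show ?thesis by (simp add: l2norm_lincomb_sq Ux assms)
  qed
  from *[of 1] *[of \<i>] show ?thesis by (simp add: complex_eq_iff)
qed

text \<open>Strict convexity of projective space at scale below \<open>\<pi>/4\<close>: the midpoint \<open>u\<close> of two lines
  is closer to every unit vector \<open>z\<close> than a bound valid for both of them, with a gain
  governed by the distance of the two lines.\<close>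

lemma projective_midpoint:
  assumes x: "x \<in> l2 I" "l2norm I x = 1" and y: "y \<in> l2 I" "l2norm I y = 1"
    and t: "l2ip I x y = of_real t" "t \<ge> 0"
  obtains u where "u \<in> l2 I" "l2norm I u = 1"
    "\<And>z. z \<in> l2 I \<Longrightarrow> l2norm I z = 1 \<Longrightarrow>
       (cmod (l2ip I z x))\<^sup>2 + (cmod (l2ip I z y))\<^sup>2 \<le> 2 * t * (cmod (l2ip I z u))\<^sup>2 + (1 - t)"
proof -
  define v where "v = (\<lambda>i. 1 * x i + y i)"
  define w where "w = (\<lambda>i. (-1) * x i + y i)"
  define r where "r = l2norm I v"
  have v: "v \<in> l2 I" and w: "w \<in> l2 I" unfolding v_def w_def by (rule l2_lincomb[OF x(1) y(1)])+
  have r2: "r\<^sup>2 = 2 + 2 * t" unfolding r_def v_def by (subst l2norm_lincomb_sq) (use x y t in auto)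
  have w2: "(l2norm I w)\<^sup>2 = 2 - 2 * t" unfolding w_def by (subst l2norm_lincomb_sq) (use x y t in auto)
  have r0: "r > 0"
  proof -
    have "r \<noteq> 0" using r2 t(2) by auto
    then show ?thesis using l2norm_nonneg[of I v] by (simp add: r_def)
  qed
  have yx: "l2ip I y x = of_real t" using l2ip_commute[of I y x] t by simp
  \<comment> \<open>Sum and difference of two unit vectors with real inner product are orthogonal.
    The midpoint \<open>u\<close> is the normalised sum.\<close>
  have vw: "l2ip I v w = 0"
    unfolding v_def
    by (subst l2ip_lincomb_left[OF x(1) y(1) w])
      (unfold w_def, simp only: l2ip_lincomb_right x y, simp add: l2ip_self x y t yx)
  define u where "u = (\<lambda>i. of_real (1 / r) * v i)"
  have u: "u \<in> l2 I" unfolding u_def by (rule l2_scale[OF v])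
  have u1: "l2norm I u = 1"
    unfolding u_def by (subst l2norm_scale[OF v]) (use r0 in \<open>simp add: r_def[symmetric] norm_divide\<close>)
  have "(cmod (l2ip I z x))\<^sup>2 + (cmod (l2ip I z y))\<^sup>2 \<le> 2 * t * (cmod (l2ip I z u))\<^sup>2 + (1 - t)"
    if z: "z \<in> l2 I" "l2norm I z = 1" for z
  proof -
    let ?a = "l2ip I z u"
    have zv: "l2ip I z v = l2ip I z x + l2ip I z y"
      using l2ip_lincomb_right[OF x(1) y(1) z(1), of 1] by (simp add: v_def)
    have zw: "l2ip I z w = l2ip I z y - l2ip I z x"
      using l2ip_lincomb_right[OF x(1) y(1) z(1), of "-1"] by (simp add: w_def)
    have zu: "l2ip I z v = of_real r * ?a"
      unfolding u_def by (subst l2ip_scale_right[OF v z(1)]) (use r0 in simp)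
    have uw: "l2ip I u w = 0" unfolding u_def by (subst l2ip_scale_left[OF v w]) (simp add: vw)
    \<comment> \<open>\<open>?q\<close> is the component of \<open>z\<close> orthogonal to
      \<open>u\<close>. Since \<open>w\<close> is orthogonal to \<open>u\<close>, pairing
      \<open>z\<close> with \<open>w\<close> sees only \<open>?q\<close>, which yields the sharper
      bound \<open>Q\<close>; the parallelogram law then recombines \<open>v\<close> and
      \<open>w\<close>.\<close>
    let ?q = "\<lambda>i. (- ?a) * u i + z i"
    have q: "?q \<in> l2 I" by (rule l2_lincomb[OF u z(1)])
    have "(l2norm I ?q)\<^sup>2 = (cmod ?a)\<^sup>2 + 2 * Re (- (?a * cnj ?a)) + 1"
      by (subst l2norm_lincomb_sq[OF u z(1)]) (simp add: u1 z l2ip_commute[of I u z])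
    also have "\<dots> = 1 - (cmod ?a)\<^sup>2" by (simp add: complex_norm_square[symmetric])
    finally have q2: "(l2norm I ?q)\<^sup>2 = 1 - (cmod ?a)\<^sup>2" .
    have "l2ip I ?q w = l2ip I z w" using l2ip_lincomb_left[OF u z(1) w, of "- ?a"] uw by simp
    then have "(cmod (l2ip I z w))\<^sup>2 \<le> (l2norm I ?q * l2norm I w)\<^sup>2"
      using l2_Cauchy_Schwarz[OF q w] by (simp add: power_mono)
    then have Q: "(cmod (l2ip I z w))\<^sup>2 \<le> (1 - (cmod ?a)\<^sup>2) * (2 - 2 * t)"
      by (simp only: power_mult_distrib q2 w2)
    have "(cmod (l2ip I z v))\<^sup>2 = r\<^sup>2 * (cmod ?a)\<^sup>2" by (simp add: zu norm_mult power_mult_distrib)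
    then have P: "(cmod (l2ip I z v))\<^sup>2 = (2 + 2 * t) * (cmod ?a)\<^sup>2" by (simp only: r2)
    have "2 * ((cmod (l2ip I z x))\<^sup>2 + (cmod (l2ip I z y))\<^sup>2) =
        (cmod (l2ip I z v))\<^sup>2 + (cmod (l2ip I z w))\<^sup>2"
      unfolding zv zw cmod_power2 by (simp add: power2_eq_square algebra_simps)
    also have "\<dots> \<le> (2 + 2 * t) * (cmod ?a)\<^sup>2 + (1 - (cmod ?a)\<^sup>2) * (2 - 2 * t)"
      using P Q by simp
    also have "\<dots> = 2 * (2 * t * (cmod ?a)\<^sup>2 + (1 - t))" by (simp add: algebra_simps)
    finally show ?thesis by simp
  qed
  with u u1 show ?thesis by (rule that)
qed

section \<open>Reduced words and the Brooks quasimorphism\<close>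

definition letter_inv :: "'g \<times> bool \<Rightarrow> 'g \<times> bool" where
  "letter_inv x = (fst x, \<not> snd x)"

definition word_inv :: "('g \<times> bool) list \<Rightarrow> ('g \<times> bool) list" where
  "word_inv w = rev (map letter_inv w)"

lemma letter_inv_inv [simp]: "letter_inv (letter_inv x) = x"
  by (simp add: letter_inv_def)

lemma fst_letter_inv [simp]: "fst (letter_inv x) = fst x"
  by (simp add: letter_inv_def)

lemma word_inv_simps [simp]:
  "word_inv [] = []" "word_inv (x # w) = word_inv w @ [letter_inv x]"
  "word_inv (u @ v) = word_inv v @ word_inv u" "word_inv w = [] \<longleftrightarrow> w = []"
  "fst ` set (word_inv w) = fst ` set w"
  by (auto simp: word_inv_def image_image)

text \<open>Reducedness constrains neighbouring letters only, so the library facts on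
  \<open>successively\<close> under append, reversal and map become available.\<close>

lemma reduced_word_iff: "reduced_word w \<longleftrightarrow> successively (\<lambda>x y. y \<noteq> letter_inv x) w"
  by (induction w rule: reduced_word.induct) (auto simp: letter_inv_def)

lemma reduced_word_append_iff:
  "reduced_word (u @ v) \<longleftrightarrow> reduced_word u \<and> reduced_word v \<and>
     (u = [] \<or> v = [] \<or> hd v \<noteq> letter_inv (last u))"
  by (auto simp: reduced_word_iff successively_append_iff)

lemma reduced_word_inv: "reduced_word w \<Longrightarrow> reduced_word (word_inv w)"
  unfolding reduced_word_iff word_inv_def successively_rev successively_map
  by (erule successively_mono) auto

text \<open>Free cancellation: the last letter of \<open>u\<close> is removed against the first
  letter of \<open>v\<close> as long as they are inverse to each other; \<open>c\<close> collects
  what cancels.\<close>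

lemma reduced_words_cancel:
  assumes "reduced_word u" "reduced_word v"
  obtains p c q where "u = p @ c" "v = word_inv c @ q" "reduced_word (p @ q)"
  using assms
proof (induction u arbitrary: v thesis rule: rev_induct)
  case Nil
  from Nil(1)[of "[]" "[]" v] Nil(3) show ?case by simp
next
  case (snoc x u)
  show ?case
  proof (cases "v \<noteq> [] \<and> hd v = letter_inv x")
    case True
    then obtain v' where v: "v = letter_inv x # v'" by (cases v) auto
    have "reduced_word u" "reduced_word v'"
      using snoc.prems(2,3) v reduced_word_append_iff[of "[letter_inv x]" v']
      by (auto simp: reduced_word_append_iff)
    with snoc.IH obtain p c q where "u = p @ c" "v' = word_inv c @ q" "reduced_word (p @ q)"
      by blast
    with snoc.prems(1)[of p "c @ [x]" q] v show ?thesis by simp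
  next
    case False
    with snoc.prems(2,3) have "reduced_word ((u @ [x]) @ v)"
      unfolding reduced_word_append_iff[of "u @ [x]" v] by auto
    with snoc.prems(1)[of "u @ [x]" "[]" v] show ?thesis by simp
  qed
qed

context group
begin

lemma word_eval_closed: "fst ` set w \<subseteq> carrier G \<Longrightarrow> word_eval G w \<in> carrier G"
  by (induction w) (auto split: prod.splits)

lemma word_eval_append:
  "fst ` set u \<subseteq> carrier G \<Longrightarrow> fst ` set v \<subseteq> carrier G \<Longrightarrow>
     word_eval G (u @ v) = word_eval G u \<otimes> word_eval G v"
  by (induction u) (auto simp: word_eval_closed m_assoc)

lemma word_eval_inv:
  "fst ` set u \<subseteq> carrier G \<Longrightarrow> word_eval G (word_inv u) = inv (word_eval G u)"
  by (induction u)
    (auto simp: word_eval_closed word_eval_append inv_mult_group letter_inv_def)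

lemma word_eval_cancel:
  assumes c: "fst ` set p \<subseteq> carrier G" "fst ` set c \<subseteq> carrier G" "fst ` set q \<subseteq> carrier G"
  shows "word_eval G (p @ c) \<otimes> word_eval G (word_inv c @ q) = word_eval G (p @ q)"
proof -
  note cl = c[THEN word_eval_closed]
  have "word_eval G c \<otimes> (inv (word_eval G c) \<otimes> word_eval G q) = word_eval G q"
    using cl by (simp add: m_assoc[symmetric])
  then show ?thesis using cl by (simp add: word_eval_append word_eval_inv c m_assoc)
qed

text \<open>Common first letters are stripped off. Once the first letters differ, the inverse of one
  word followed by the other is a nonempty reduced word with value one, which freeness
  forbids.\<close>

lemma reduced_word_unique:
  assumes S: "free_basis G S"
    and "reduced_word u" "fst ` set u \<subseteq> S" "reduced_word v" "fst ` set v \<subseteq> S"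
    and "word_eval G u = word_eval G v"
  shows "u = v"
  using assms(2-)
proof (induction u arbitrary: v)
  case Nil
  then show ?case using S unfolding free_basis_def by (metis word_eval.simps(1))
next
  case (Cons x u)
  have SG: "S \<subseteq> carrier G" using S by (simp add: free_basis_def)
  show ?case
  proof (cases v)
    case Nil
    then show ?thesis using S Cons.prems unfolding free_basis_def
      by (metis list.distinct(1) word_eval.simps(1))
  next
    case v: (Cons y w)
    have c: "fst ` set (x # u) \<subseteq> carrier G" "fst ` set v \<subseteq> carrier G"
      using Cons.prems SG by auto
    show ?thesis
    proof (cases "x = y")
      case True
      have "word_eval G ([x] @ u) = word_eval G ([x] @ w)" using Cons.prems True v by simp
      then have "word_eval G [x] \<otimes> word_eval G u = word_eval G [x] \<otimes> word_eval G w"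
        using c v True by (subst (asm) (1 2) word_eval_append) auto
      then have "word_eval G u = word_eval G w"
        using c v by (subst (asm) Units_l_cancel) (auto intro!: word_eval_closed simp del: word_eval.simps)
      moreover have "reduced_word u" "reduced_word w"
        using Cons.prems v reduced_word_append_iff[of "[x]" u] reduced_word_append_iff[of "[y]" w] by auto
      ultimately show ?thesis using Cons.IH[of w] Cons.prems v True by auto
    next
      case False
      have "reduced_word (word_inv (x # u) @ v)"
        unfolding reduced_word_append_iff using Cons.prems v False reduced_word_inv[of "x # u"] by simp
      moreover have "fst ` set (word_inv (x # u) @ v) \<subseteq> S"
        using Cons.prems(2,4) word_inv_simps(5)[of "x # u"] by (simp add: image_Un)
      moreover have "word_inv (x # u) @ v \<noteq> []" by simp
      ultimately have "word_eval G (word_inv (x # u) @ v) \<noteq> \<one>"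
        using S unfolding free_basis_def by blast
      moreover have "word_eval G (word_inv (x # u) @ v) = inv (word_eval G (x # u)) \<otimes> word_eval G v"
        using c by (subst word_eval_append) (auto simp: word_eval_inv simp del: word_inv_simps(2) simp: word_inv_simps(5))
      ultimately show ?thesis using Cons.prems(5) word_eval_closed[OF c(2)] by simp
    qed
  qed
qed

lemma generate_reduced_word:
  assumes "S \<subseteq> carrier G" "h \<in> generate G S"
  obtains w where "reduced_word w" "fst ` set w \<subseteq> S" "word_eval G w = h"
  using assms(2)
proof (induction arbitrary: thesis)
  case one
  then show ?case by (metis empty_subsetI image_empty list.set(1) reduced_word.simps(2) word_eval.simps(1))
next
  case (incl h)
  then show ?case using incl(2)[of "[(h, True)]"] assms(1) by auto
next
  case (inv h)
  then show ?case using inv(2)[of "[(h, False)]"] assms(1) by auto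
next
  case (eng h1 h2)
  obtain u where u: "reduced_word u" "fst ` set u \<subseteq> S" "word_eval G u = h1" using eng.IH(1) by blast
  obtain v where v: "reduced_word v" "fst ` set v \<subseteq> S" "word_eval G v = h2" using eng.IH(2) by blast
  obtain p c q where pcq: "u = p @ c" "v = word_inv c @ q" "reduced_word (p @ q)"
    using reduced_words_cancel[OF u(1) v(1)] by blast
  have S: "fst ` set p \<subseteq> S" "fst ` set q \<subseteq> S" "fst ` set c \<subseteq> S"
    using u v pcq by auto
  have "word_eval G (p @ q) = h1 \<otimes> h2"
    unfolding u(3)[symmetric] v(3)[symmetric] pcq(1,2)
    by (rule word_eval_cancel[symmetric]) (use S assms(1) in blast)+
  moreover have "fst ` set (p @ q) \<subseteq> S" using S by auto
  ultimately show ?case using eng.prems pcq(3) by blast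
qed

end

section \<open>Counting pairs of adjacent letters\<close>

fun adjacent_sum :: "('a \<Rightarrow> 'a \<Rightarrow> real) \<Rightarrow> 'a list \<Rightarrow> real" where
  "adjacent_sum f (x # y # w) = f x y + adjacent_sum f (y # w)"
| "adjacent_sum f _ = 0"

lemma adjacent_sum_append:
  "u \<noteq> [] \<Longrightarrow> v \<noteq> [] \<Longrightarrow>
     adjacent_sum f (u @ v) = adjacent_sum f u + f (last u) (hd v) + adjacent_sum f v"
proof (induction f u rule: adjacent_sum.induct)
  case ("2_2" f x)
  then show ?case by (cases v) auto
qed auto

text \<open>Joining two lists creates one new adjacent pair, and none if either list is
  empty.\<close>

lemma adjacent_sum_append_le:
  assumes "\<And>x y. \<bar>f x y\<bar> \<le> 1"
  shows "\<bar>adjacent_sum f (u @ v) - adjacent_sum f u - adjacent_sum f v\<bar> \<le> 1"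
  using assms[of "last u" "hd v"] by (cases "u = [] \<or> v = []") (auto simp: adjacent_sum_append)

text \<open>Inverting a word turns each adjacent pair \<open>x\<close>, \<open>y\<close> into the
  pair of inverse letters in opposite order, so oddness of \<open>f\<close> on pairs passes to the
  whole sum.\<close>

lemma adjacent_sum_word_inv:
  assumes "\<And>x y. f (letter_inv y) (letter_inv x) = - f x y"
  shows "adjacent_sum f (word_inv w) = - adjacent_sum f w"
  using assms
proof (induction f w rule: adjacent_sum.induct)
  case (1 f x y w)
  have "adjacent_sum f (word_inv (x # y # w)) = adjacent_sum f (word_inv (y # w) @ [letter_inv x])"
    by simp
  also have "\<dots> = - adjacent_sum f (x # y # w)"
    by (subst adjacent_sum_append) (use 1 in auto)
  finally show ?case .
qed auto

text \<open>The negative case is the inverse of the word \<open>ab\<close>; it makes the count odd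
  under inversion, so that cancelled pieces contribute opposite amounts.\<close>

definition count_ab :: "'g \<Rightarrow> 'g \<Rightarrow> 'g \<times> bool \<Rightarrow> 'g \<times> bool \<Rightarrow> real" where
  "count_ab a b x y =
     (if x = (a, True) \<and> y = (b, True) then 1
      else if x = (b, False) \<and> y = (a, False) then - 1 else 0)"

text \<open>The Brooks counting quasimorphism of the word \<open>ab\<close>: cancellation in a product of reduced
  words cancels the counts as well, up to one error term at each of three junctions.\<close>

lemma (in group) exists_quasimorphism:
  assumes ab: "free_basis G {a, b}" "a \<noteq> b"
  obtains \<phi> :: "'a \<Rightarrow> real" where
    "\<And>h k. h \<in> generate G {a, b} \<Longrightarrow> k \<in> generate G {a, b} \<Longrightarrow> \<bar>\<phi> (h \<otimes> k) - (\<phi> h + \<phi> k)\<bar> \<le> 3"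
    "\<And>n :: nat. \<phi> (a [^] n) = 0" "\<And>n :: nat. \<phi> (b [^] n) = 0"
    "\<And>n :: nat. \<phi> ((a \<otimes> b) [^] n) = real n"
proof -
  let ?f = "count_ab a b"
  let ?W = "\<lambda>w. reduced_word w \<and> fst ` set w \<subseteq> {a, b}"
  \<comment> \<open>On the subgroup generated by \<open>a\<close> and \<open>b\<close> the reduced
    word exists and is unique by freeness, so \<open>THE\<close> picks it out.\<close>
  define \<phi> where "\<phi> h = adjacent_sum ?f (THE w. ?W w \<and> word_eval G w = h)" for h
  have S: "{a, b} \<subseteq> carrier G" using ab by (simp add: free_basis_def)
  have f1: "\<bar>?f x y\<bar> \<le> 1" for x y by (simp add: count_ab_def)
  have finv: "?f (letter_inv y) (letter_inv x) = - ?f x y" for x y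
    by (cases x; cases y) (auto simp: count_ab_def letter_inv_def)
  have \<phi>: "\<phi> (word_eval G w) = adjacent_sum ?f w" if "?W w" for w
  proof -
    have "(THE v. ?W v \<and> word_eval G v = word_eval G w) = w"
      using that reduced_word_unique[OF ab(1)] by (intro the_equality) blast+
    then show ?thesis by (simp add: \<phi>_def)
  qed
  have quasi: "\<bar>\<phi> (h \<otimes> k) - (\<phi> h + \<phi> k)\<bar> \<le> 3"
    if hk: "h \<in> generate G {a, b}" "k \<in> generate G {a, b}" for h k
  proof -
    obtain u where u: "?W u" "word_eval G u = h" using generate_reduced_word[OF S hk(1)] by blast
    obtain v where v: "?W v" "word_eval G v = k" using generate_reduced_word[OF S hk(2)] by blast
    obtain p c q where pcq: "u = p @ c" "v = word_inv c @ q" "reduced_word (p @ q)"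
      using u(1) v(1) by (elim conjE reduced_words_cancel[of u v])
    have W: "fst ` set p \<subseteq> {a, b}" "fst ` set q \<subseteq> {a, b}" "fst ` set c \<subseteq> {a, b}"
      using u v pcq(1,2) word_inv_simps(5)[of c] by (auto simp: image_Un)
    have "word_eval G (p @ q) = h \<otimes> k"
      unfolding u(2)[symmetric] v(2)[symmetric] pcq(1,2)
      by (rule word_eval_cancel[symmetric]) (use W S in blast)+
    then have "\<phi> (h \<otimes> k) = adjacent_sum ?f (p @ q)"
      using \<phi>[of "p @ q"] pcq(3) W by (simp add: image_Un)
    moreover have "\<phi> h = adjacent_sum ?f (p @ c)" "\<phi> k = adjacent_sum ?f (word_inv c @ q)"
      using \<phi> u v pcq by auto
    moreover have "adjacent_sum ?f (word_inv c) = - adjacent_sum ?f c"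
      by (rule adjacent_sum_word_inv) (rule finv)
    ultimately show ?thesis
      using adjacent_sum_append_le[of ?f p q, OF f1] adjacent_sum_append_le[of ?f p c, OF f1]
        adjacent_sum_append_le[of ?f "word_inv c" q, OF f1] by linarith
  qed
  have zero: "\<phi> (s [^] n) = 0" if s: "s \<in> {a, b}" for s and n :: nat
  proof -
    let ?w = "replicate n (s, True)"
    have "word_eval G ?w = s [^] n"
      using s S by (induction n) (auto simp: nat_pow_Suc2[symmetric] simp del: nat_pow_Suc)
    moreover have "reduced_word ?w \<and> adjacent_sum ?f ?w = 0"
    proof (induction n)
      case (Suc n)
      then show ?case using ab(2) by (cases n) (auto simp: count_ab_def)
    qed simp
    moreover have "fst ` set ?w \<subseteq> {a, b}" using s by auto
    ultimately show ?thesis using \<phi>[of ?w] by simp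
  qed
  have "\<phi> ((a \<otimes> b) [^] n) = real n" for n :: nat
  proof -
    let ?w = "\<lambda>n. concat (replicate n [(a, True), (b, True)])"
    have "word_eval G (?w n) = (a \<otimes> b) [^] n"
    proof (induction n)
      case (Suc n)
      have "(a \<otimes> b) [^] Suc n = (a \<otimes> b) \<otimes> (a \<otimes> b) [^] n"
        using S by (intro nat_pow_Suc2) simp
      then show ?case using Suc S by (simp add: m_assoc del: nat_pow_Suc)
    qed simp
    \<comment> \<open>The leading \<open>b\<close> strengthens the induction: after removing one
      block \<open>ab\<close>, the remaining powers are again preceded by a \<open>b\<close>. The
      junction \<open>ba\<close> counts zero.\<close>
    moreover have *: "reduced_word ((b, True) # ?w n) \<and> adjacent_sum ?f ((b, True) # ?w n) = n" for n
      using ab(2) by (induction n) (auto simp: count_ab_def)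
    have "reduced_word (?w n) \<and> adjacent_sum ?f (?w n) = n"
    proof (cases n)
      case (Suc m)
      then show ?thesis using *[of m] by (simp add: count_ab_def)
    qed simp
    moreover have "fst ` set (?w n) \<subseteq> {a, b}" by auto
    ultimately show ?thesis using \<phi>[of "?w n"] by simp
  qed
  with quasi zero[of a] zero[of b] show ?thesis by (intro that[of \<phi>]) simp_all
qed

section \<open>Two free generators inside a non-abelian free subgroup\<close>

lemma free_basis_subset: "free_basis G S \<Longrightarrow> T \<subseteq> S \<Longrightarrow> free_basis G T"
  unfolding free_basis_def by (metis subset_trans)

lemma (in group) free_basis_pair_of_nonabelian:
  assumes "has_nonabelian_free_subgroup G"
  obtains a b where "a \<noteq> b" "free_basis G {a, b}"
proof -
  obtain S where S: "free_basis G S" "\<not> (\<forall>x\<in>generate G S. \<forall>y\<in>generate G S. x \<otimes> y = y \<otimes> x)"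
    using assms by (auto simp: has_nonabelian_free_subgroup_def free_subgroup_def)
  have SG: "S \<subseteq> carrier G" using S by (simp add: free_basis_def)
  \<comment> \<open>A basis with at most one element generates a cyclic group, which is
    abelian.\<close>
  have "\<exists>a\<in>S. \<exists>b\<in>S. a \<noteq> b"
  proof (rule ccontr)
    assume "\<not> ?thesis"
    then consider "S = {}" | s where "S = {s}" by blast
    then show False
    proof cases
      case 1
      then show False using S(2) by (simp add: generate_empty)
    next
      case (2 s)
      then have s: "s \<in> carrier G" using SG by simp
      have "s [^] (m::int) \<otimes> s [^] (n::int) = s [^] n \<otimes> s [^] m" for m n
        using s by (simp add: int_pow_mult[symmetric] add.commute)
      then show False using S(2) unfolding 2 generate_pow[OF s] by blast
    qed
  qed
  then obtain a b where "a \<in> S" "b \<in> S" "a \<noteq> b" by blast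
  moreover from this have "free_basis G {a, b}"
    by (intro free_basis_subset[OF S(1)]) auto
  ultimately show ?thesis using that by blast
qed

section \<open>Induced almost representations\<close>

text \<open>The only estimate needed for weighted permutations of coordinates: it gives membership
  and norm bounds for the induced operators, their inverses and their defect alike.\<close>

lemma l2_dominated:
  assumes \<pi>: "bij_betw \<pi> I I" and x: "x \<in> l2 I" and "d \<ge> 0"
    and le: "\<And>i. i \<in> I \<Longrightarrow> cmod (z i) \<le> d * cmod (x (\<pi> i))" and 0: "\<And>i. i \<notin> I \<Longrightarrow> z i = 0"
  shows "z \<in> l2 I" "l2norm I z \<le> d * l2norm I x"
proof -
  have le2: "(cmod (z i))\<^sup>2 \<le> d\<^sup>2 * (cmod (x (\<pi> i)))\<^sup>2" if "i \<in> I" for i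
    using power_mono[OF le[OF that], of 2] by (simp add: power_mult_distrib)
  have "(\<lambda>i. (cmod (x (\<pi> i)))\<^sup>2) summable_on I"
    using x summable_on_reindex_bij_betw[OF \<pi>, of "\<lambda>i. (cmod (x i))\<^sup>2"] by (simp add: l2_def)
  then have s: "(\<lambda>i. d\<^sup>2 * (cmod (x (\<pi> i)))\<^sup>2) summable_on I"
    by (rule summable_on_cmult_right)
  then have sz: "(\<lambda>i. (cmod (z i))\<^sup>2) summable_on I"
    by (rule summable_on_comparison_test) (auto simp: le2)
  then show "z \<in> l2 I" using 0 by (simp add: l2_def)
  have "infsum (\<lambda>i. (cmod (z i))\<^sup>2) I \<le> infsum (\<lambda>i. d\<^sup>2 * (cmod (x (\<pi> i)))\<^sup>2) I"
    by (rule infsum_mono[OF sz s le2])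
  also have "\<dots> = d\<^sup>2 * infsum (\<lambda>i. (cmod (x i))\<^sup>2) I"
    using infsum_reindex_bij_betw[OF \<pi>, of "\<lambda>i. (cmod (x i))\<^sup>2"] by (simp add: infsum_cmult_right')
  finally have "l2norm I z \<le> sqrt (d\<^sup>2 * infsum (\<lambda>i. (cmod (x i))\<^sup>2) I)"
    unfolding l2norm_def by (rule real_sqrt_le_mono)
  then show "l2norm I z \<le> d * l2norm I x"
    using \<open>d \<ge> 0\<close> by (simp add: real_sqrt_mult l2norm_def)
qed

text \<open>A generalised permutation matrix with weights \<open>m\<close>. The value zero off
  \<open>I\<close> respects the convention that elements of \<open>l2 I\<close> vanish
  there.\<close>

definition monomial_op ::
    "'i set \<Rightarrow> ('i \<Rightarrow> complex) \<Rightarrow> ('i \<Rightarrow> 'i) \<Rightarrow> ('i \<Rightarrow> complex) \<Rightarrow> 'i \<Rightarrow> complex" where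
  "monomial_op I m \<pi> x i = (if i \<in> I then m i * x (\<pi> i) else 0)"

lemma unitary_monomial_op:
  assumes \<pi>: "bij_betw \<pi> I I" and m: "\<And>i. i \<in> I \<Longrightarrow> cmod (m i) = 1"
  shows "unitary_op I (monomial_op I m \<pi>)"
proof -
  let ?U = "monomial_op I m \<pi>" and ?\<rho> = "inv_into I \<pi>"
  have \<rho>: "bij_betw ?\<rho> I I" by (rule bij_betw_inv_into[OF \<pi>])
  have inv: "\<pi> (?\<rho> i) = i" "?\<rho> (\<pi> i) = i" "\<pi> i \<in> I" "?\<rho> i \<in> I" if "i \<in> I" for i
    using that \<pi> bij_betw_inv_into_left[OF \<pi>] bij_betw_inv_into_right[OF \<pi>] bij_betwE[OF \<pi>] bij_betwE[OF \<rho>]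
    by auto
  have U: "?U x \<in> l2 I" "l2norm I (?U x) \<le> l2norm I x" if x: "x \<in> l2 I" for x
    using l2_dominated[OF \<pi> x, of 1 "?U x"] by (auto simp: monomial_op_def norm_mult m)
  \<comment> \<open>The reverse inequality comes from the same domination lemma, applied to the
    inverse permutation.\<close>
  have U': "l2norm I x \<le> l2norm I (?U x)" if x: "x \<in> l2 I" for x
    using l2_dominated(2)[OF \<rho> U(1)[OF x], of 1 x] x
    by (auto simp: monomial_op_def norm_mult m inv l2_def)
  have surj: "\<exists>x\<in>l2 I. ?U x = y" if y: "y \<in> l2 I" for y
  proof
    let ?x = "\<lambda>i. if i \<in> I then cnj (m (?\<rho> i)) * y (?\<rho> i) else 0"
    show "?x \<in> l2 I"
      by (rule l2_dominated(1)[OF \<rho> y, of 1]) (auto simp: norm_mult m inv)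
    have "m i * cnj (m i) = 1" if "i \<in> I" for i
      using m[OF that] by (metis complex_norm_square of_real_1 one_power2)
    then show "?U ?x = y" using y
      by (auto simp: monomial_op_def inv l2_def fun_eq_iff mult.assoc[symmetric])
  qed
  have "?U (\<lambda>i. c * x i + y i) = (\<lambda>i. c * ?U x i + ?U y i)" for c x y
    by (auto simp: monomial_op_def fun_eq_iff algebra_simps)
  then show ?thesis
    unfolding unitary_op_def using U U' surj by (auto intro: antisym)
qed

lemma opnorm_le:
  assumes "\<And>x. x \<in> l2 I \<Longrightarrow> l2norm I x \<le> 1 \<Longrightarrow> l2norm I (T x) \<le> d"
  shows "opnorm I T \<le> d"
proof -
  have "{x \<in> l2 I. l2norm I x \<le> 1} \<noteq> {}"
    using l2_zero[of I] l2norm_zero[of I] by auto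
  then show ?thesis unfolding opnorm_def by (rule cSUP_least) (use assms in auto)
qed

text \<open>The uniform bound \<open>d\<close> guarantees that the real supremum defining
  \<open>opnorm\<close> is a genuine upper bound.\<close>

lemma le_opnorm:
  assumes "\<And>x. x \<in> l2 I \<Longrightarrow> l2norm I x \<le> 1 \<Longrightarrow> l2norm I (T x) \<le> d" "x \<in> l2 I" "l2norm I x \<le> 1"
  shows "l2norm I (T x) \<le> opnorm I T"
  unfolding opnorm_def by (rule cSUP_upper) (use assms in \<open>auto intro!: bdd_aboveI2\<close>)

lemma defect_le:
  assumes "group G"
    and "\<And>g k v. g \<in> carrier G \<Longrightarrow> k \<in> carrier G \<Longrightarrow> v \<in> l2 I \<Longrightarrow> l2norm I v \<le> 1 \<Longrightarrow>
      l2norm I (\<mu> (g \<otimes>\<^bsub>G\<^esub> k) v - \<mu> g (\<mu> k v)) \<le> d"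
  shows "defect G I \<mu> \<le> d"
proof -
  interpret group G by fact
  have "carrier G \<times> carrier G \<noteq> {}" by auto
  then show ?thesis unfolding defect_def by (rule cSUP_least) (auto intro!: opnorm_le assms)
qed

definition kronecker :: "'i \<Rightarrow> 'i \<Rightarrow> complex" where
  "kronecker i = (\<lambda>j. if j = i then 1 else 0)"

lemma kronecker_l2:
  assumes "i \<in> I"
  shows "kronecker i \<in> l2 I" "l2norm I (kronecker i) = 1"
proof -
  have *: "((\<lambda>j. (cmod (kronecker i j))\<^sup>2) has_sum (\<Sum>j\<in>{i}. (cmod (kronecker i j))\<^sup>2)) I"
    by (rule has_sum_finite_neutralI[of "{i}"]) (use assms in \<open>auto simp: kronecker_def\<close>)
  then show "l2norm I (kronecker i) = 1"
    by (simp add: l2norm_def infsumI kronecker_def)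
  show "kronecker i \<in> l2 I"
    using * assms by (auto simp: l2_def kronecker_def summable_on_def)
qed

lemma (in group) coset_representatives:
  assumes "subgroup H G"
  obtains r where "\<And>x. x \<in> carrier G \<Longrightarrow> r x \<in> carrier G"
    "\<And>x. x \<in> carrier G \<Longrightarrow> inv x \<otimes> r x \<in> H"
    "\<And>x h. x \<in> carrier G \<Longrightarrow> h \<in> H \<Longrightarrow> r (x \<otimes> h) = r x"
    "\<And>h. h \<in> H \<Longrightarrow> r h = \<one>"
proof -
  interpret H: subgroup H G by fact
  define E where "E x = {y \<in> carrier G. inv x \<otimes> y \<in> H}" for x
  \<comment> \<open>\<open>E x\<close> is the left coset of \<open>x\<close>, so the choice depends
    on the coset only. Fixing the representative of \<open>H\<close> itself to be one makes the base
    coordinate an exact eigenvector later.\<close>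
  define r where "r x = (if x \<in> H then \<one> else SOME y. y \<in> E x)" for x
  have E1: "x \<in> E x" if "x \<in> carrier G" for x using that by (simp add: E_def)
  have rE: "r x \<in> E x" if x: "x \<in> carrier G" for x
    using E1[OF x] someI[of "\<lambda>y. y \<in> E x"] by (auto simp: r_def E_def)
  have E: "E (x \<otimes> h) = E x" if "x \<in> carrier G" "h \<in> H" for x h
  proof -
    have "inv h \<otimes> (inv x \<otimes> y) \<in> H \<longleftrightarrow> inv x \<otimes> y \<in> H" if y: "y \<in> carrier G" for y
    proof
      assume "inv h \<otimes> (inv x \<otimes> y) \<in> H"
      then have "h \<otimes> (inv h \<otimes> (inv x \<otimes> y)) \<in> H" using \<open>h \<in> H\<close> by simp
      then show "inv x \<otimes> y \<in> H"
        using \<open>h \<in> H\<close> \<open>x \<in> carrier G\<close> y by (simp add: m_assoc[symmetric])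
    qed (use \<open>h \<in> H\<close> in simp)
    then show ?thesis using that by (auto simp: E_def inv_mult_group m_assoc)
  qed
  have "x \<otimes> h \<in> H \<longleftrightarrow> x \<in> H" if "x \<in> carrier G" "h \<in> H" for x h
  proof
    assume "x \<otimes> h \<in> H"
    then have "x \<otimes> h \<otimes> inv h \<in> H" using that by simp
    then show "x \<in> H" using that by (simp add: m_assoc)
  qed (use that in simp)
  then have "r (x \<otimes> h) = r x" if "x \<in> carrier G" "h \<in> H" for x h
    using that E by (simp add: r_def)
  moreover have "r h = \<one>" if "h \<in> H" for h using that by (simp add: r_def)
  ultimately show ?thesis using that[of r] rE by (auto simp: E_def)
qed

text \<open>Induction of an almost-character \<open>\<theta>\<close> of \<open>H\<close>: the operators act on the square-summable
  functions on a transversal of \<open>G/H\<close>, which \<open>j\<close> embeds into the index type.\<close>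

lemma (in group) induced_unitary_map:
  fixes \<theta> :: "'a \<Rightarrow> complex" and j :: "'a \<Rightarrow> 'i"
  assumes "subgroup H G" and j: "inj j" and "d \<ge> 0"
    and \<theta>: "\<And>h. h \<in> H \<Longrightarrow> cmod (\<theta> h) = 1" "\<theta> \<one> = 1"
      "\<And>h k. h \<in> H \<Longrightarrow> k \<in> H \<Longrightarrow> cmod (\<theta> (h \<otimes> k) - \<theta> h * \<theta> k) \<le> d"
  obtains I :: "'i set" and \<mu> \<xi> where "unitary_map G I \<mu>" "\<And>v. v \<in> l2 I \<Longrightarrow> \<mu> \<one> v = v" "defect G I \<mu> \<le> d"
    "\<xi> \<in> l2 I" "l2norm I \<xi> = 1" "\<And>h. h \<in> H \<Longrightarrow> \<mu> h \<xi> = (\<lambda>i. \<theta> h * \<xi> i)"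
proof -
  interpret H: subgroup H G by fact
  obtain r where r: "\<And>x. x \<in> carrier G \<Longrightarrow> r x \<in> carrier G"
    "\<And>x. x \<in> carrier G \<Longrightarrow> inv x \<otimes> r x \<in> H"
    "\<And>x h. x \<in> carrier G \<Longrightarrow> h \<in> H \<Longrightarrow> r (x \<otimes> h) = r x"
    "\<And>h. h \<in> H \<Longrightarrow> r h = \<one>"
    using coset_representatives[OF assms(1)] by blast
  define T where "T = r ` carrier G"
  have TG: "y \<in> carrier G" if "y \<in> T" for y using that r by (auto simp: T_def)
  have r_split: "r x = x \<otimes> (inv x \<otimes> r x)" if "x \<in> carrier G" for x
    using that r(1) by (simp add: m_assoc[symmetric])
  have r_mult: "r (g \<otimes> r x) = r (g \<otimes> x)" if "g \<in> carrier G" "x \<in> carrier G" for g x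
  proof -
    have "g \<otimes> r x = (g \<otimes> x) \<otimes> (inv x \<otimes> r x)"
      using that r(1) by (subst r_split) (simp_all add: m_assoc)
    then show ?thesis using that r by simp
  qed
  have rT: "r y = y" if "y \<in> T" for y
    using that r_mult[of \<one>] r(1) by (auto simp: T_def)
  have rrT: "r x \<in> T" if "x \<in> carrier G" for x using that by (simp add: T_def)
  have act_inv: "r (g \<otimes> r (inv g \<otimes> y)) = y" if "g \<in> carrier G" "y \<in> T" for g y
    using that TG by (simp add: r_mult rT m_assoc[symmetric])
  \<comment> \<open>The usual formulas for an induced representation in coordinates:
    \<open>act g\<close> permutes the transversal, and \<open>m g\<close> applies
    \<open>\<theta>\<close> to the element of \<open>H\<close> by which representatives are off.
    \<open>inv_into UNIV j\<close> recovers the coset representative from its index.\<close>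
  define act where "act g i = j (r (inv g \<otimes> inv_into UNIV j i))" for g i
  define m where "m g i = (let y = inv_into UNIV j i in \<theta> (inv y \<otimes> g \<otimes> r (inv g \<otimes> y)))" for g i
  define I where "I = j ` T"
  define \<mu> where "\<mu> g = monomial_op I (m g) (act g)" for g
  have act_j: "act g (j y) = j (r (inv g \<otimes> y))" and m_j: "m g (j y) = \<theta> (inv y \<otimes> g \<otimes> r (inv g \<otimes> y))"
    for g y by (simp_all add: act_def m_def j Let_def)
  have phase: "inv y \<otimes> g \<otimes> r (inv g \<otimes> y) \<in> H" if "g \<in> carrier G" "y \<in> T" for g y
    using r(2)[of "inv g \<otimes> y"] that TG by (simp add: inv_mult_group)
  have bij: "bij_betw (act g) I I" if g: "g \<in> carrier G" for g
    by (rule bij_betw_byWitness[where f' = "act (inv g)"])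
      (use g act_inv[of g] act_inv[of "inv g"] TG in \<open>auto simp: I_def act_j intro!: imageI rrT\<close>)
  have mod1: "cmod (m g i) = 1" if "g \<in> carrier G" "i \<in> I" for g i
    using that phase by (auto simp: I_def m_j \<theta>)
  have um: "unitary_map G I \<mu>"
    unfolding unitary_map_def \<mu>_def using unitary_monomial_op bij mod1 by blast
  have one: "\<mu> \<one> v = v" if "v \<in> l2 I" for v
    using that TG by (auto simp: \<mu>_def monomial_op_def fun_eq_iff I_def act_j m_j rT \<theta> l2_def)
  have def_le: "defect G I \<mu> \<le> d"
  proof (rule defect_le)
    fix g k v assume gk: "g \<in> carrier G" "k \<in> carrier G" and v: "v \<in> l2 I" "l2norm I v \<le> 1"
    have "cmod ((\<mu> (g \<otimes> k) v - \<mu> g (\<mu> k v)) i) \<le> d * cmod (v (act (g \<otimes> k) i))" if "i \<in> I" for i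
    proof -
      obtain y where y: "y \<in> T" "i = j y" using \<open>i \<in> I\<close> by (auto simp: I_def)
      define y1 where "y1 = r (inv g \<otimes> y)"
      define y2 where "y2 = r (inv k \<otimes> y1)"
      have y1: "y1 \<in> T" and y2: "y2 \<in> T" using gk y TG by (auto simp: y1_def y2_def rrT)
      note c = gk TG[OF y(1)] TG[OF y1] TG[OF y2]
      have y2': "r (inv (g \<otimes> k) \<otimes> y) = y2"
        unfolding y2_def y1_def using c by (simp add: r_mult inv_mult_group m_assoc)
      \<comment> \<open>The arguments of \<open>\<theta>\<close> satisfy an exact cocycle identity,
        so each coordinate of the defect involves a single defect of \<open>\<theta>\<close> and
        induction loses nothing.\<close>
      have prod: "inv y \<otimes> (g \<otimes> k) \<otimes> y2 = (inv y \<otimes> g \<otimes> y1) \<otimes> (inv y1 \<otimes> k \<otimes> y2)"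
      proof -
        have "y1 \<otimes> (inv y1 \<otimes> (k \<otimes> y2)) = k \<otimes> y2" using c by (simp add: m_assoc[symmetric])
        then show ?thesis using c by (simp add: m_assoc)
      qed
      have "(\<mu> (g \<otimes> k) v - \<mu> g (\<mu> k v)) i =
          (\<theta> (inv y \<otimes> (g \<otimes> k) \<otimes> y2) - \<theta> (inv y \<otimes> g \<otimes> y1) * \<theta> (inv y1 \<otimes> k \<otimes> y2)) * v (j y2)"
        using y y1 by (simp add: \<mu>_def monomial_op_def I_def act_j m_j y2' y1_def[symmetric] y2_def[symmetric]
            algebra_simps)
      moreover have "cmod (\<theta> (inv y \<otimes> (g \<otimes> k) \<otimes> y2) - \<theta> (inv y \<otimes> g \<otimes> y1) * \<theta> (inv y1 \<otimes> k \<otimes> y2)) \<le> d"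
        unfolding prod using phase[OF gk(1) y(1)] phase[OF gk(2) y1]
        by (intro \<theta>) (simp_all add: y1_def y2_def)
      ultimately show ?thesis
        by (simp add: norm_mult mult_right_mono y act_j y2')
    qed
    then have "l2norm I (\<mu> (g \<otimes> k) v - \<mu> g (\<mu> k v)) \<le> d * l2norm I v"
      by (intro l2_dominated(2)[OF bij[of "g \<otimes> k"] v(1) \<open>d \<ge> 0\<close>]) (auto simp: gk \<mu>_def monomial_op_def)
    also have "\<dots> \<le> d" using v(2) \<open>d \<ge> 0\<close> by (simp add: mult_left_le)
    finally show "l2norm I (\<mu> (g \<otimes> k) v - \<mu> g (\<mu> k v)) \<le> d" .
  qed (rule group_axioms)
  have 1: "\<one> \<in> T" using rrT[of \<one>] r(4)[of \<one>] by simp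
  have eig: "\<mu> h (kronecker (j \<one>)) = (\<lambda>i. \<theta> h * kronecker (j \<one>) i)" if h: "h \<in> H" for h
  proof
    fix i
    show "\<mu> h (kronecker (j \<one>)) i = \<theta> h * kronecker (j \<one>) i"
    proof (cases "i \<in> I")
      case True
      then obtain y where y: "y \<in> T" "i = j y" by (auto simp: I_def)
      \<comment> \<open>Elements of \<open>H\<close> fix the base coset and permute the others, so
        the delta function at the base coset only acquires a phase.\<close>
      have "r (inv h \<otimes> y) = \<one> \<longleftrightarrow> y = \<one>"
        using act_inv[of h y] r(4) h y by auto
      moreover have "m h (j \<one>) = \<theta> h" using h r(4) by (simp add: m_j)
      ultimately show ?thesis
        using True y j by (auto simp: \<mu>_def monomial_op_def act_j kronecker_def inj_eq)
    next
      case False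
      then show ?thesis using 1 by (auto simp: \<mu>_def monomial_op_def kronecker_def I_def)
    qed
  qed
  have "j \<one> \<in> I" using 1 by (simp add: I_def)
  from that[OF um one def_le kronecker_l2[OF this] eig] show ?thesis by blast
qed

section \<open>Rigidity of almost invariant lines\<close>

lemma unitary_homD:
  fixes G (structure)
  assumes "unitary_hom G I \<nu>" "group G" "g \<in> carrier G" "v \<in> l2 I"
  shows "\<nu> g v \<in> l2 I" "l2norm I (\<nu> g v) = l2norm I v"
    "k \<in> carrier G \<Longrightarrow> \<nu> (g \<otimes> k) v = \<nu> g (\<nu> k v)"
    "\<nu> \<one> v = v" "\<nu> g (\<lambda>i. c * v i) = (\<lambda>i. c * \<nu> g v i)"
    "w \<in> l2 I \<Longrightarrow> l2ip I (\<nu> g v) (\<nu> g w) = l2ip I v w"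
    "w \<in> l2 I \<Longrightarrow> \<nu> g (v - w) = \<nu> g v - \<nu> g w"
proof -
  interpret group G by fact
  have U: "unitary_op I (\<nu> g)" if "g \<in> carrier G" for g
    using assms that by (simp add: unitary_hom_def unitary_map_def)
  show "\<nu> g v \<in> l2 I" "l2norm I (\<nu> g v) = l2norm I v"
    using U[OF assms(3)] assms(4) by (simp_all add: unitary_op_def)
  show mult: "\<nu> (g \<otimes> k) v = \<nu> g (\<nu> k v)" if "k \<in> carrier G"
    using assms that by (simp add: unitary_hom_def)
  show "\<nu> \<one> v = v"
  proof -
    \<comment> \<open>The operator \<open>\<nu> \<one>\<close> is idempotent, and by surjectivity
      every vector lies in its range.\<close>
    obtain x where x: "x \<in> l2 I" "\<nu> \<one> x = v"
      using U[OF one_closed] assms(4) unfolding unitary_op_def by blast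
    have "\<nu> (\<one> \<otimes> \<one>) x = \<nu> \<one> (\<nu> \<one> x)"
      using assms(1) x(1) one_closed unfolding unitary_hom_def by blast
    then show ?thesis using x by simp
  qed
  have "\<nu> g (\<lambda>i. c * x i + y i) = (\<lambda>i. c * \<nu> g x i + \<nu> g y i)" if "x \<in> l2 I" "y \<in> l2 I" for c x y
    using U[OF assms(3)] that unfolding unitary_op_def by blast
  note lin = this
  have "\<nu> g (\<lambda>i. 0) = (\<lambda>i. 0)"
    using lin[OF l2_zero l2_zero, of 1] by (simp add: fun_eq_iff)
  then show "\<nu> g (\<lambda>i. c * v i) = (\<lambda>i. c * \<nu> g v i)"
    using lin[OF assms(4) l2_zero, of c] by simp
  show "l2ip I (\<nu> g v) (\<nu> g w) = l2ip I v w" if "w \<in> l2 I"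
    using unitary_op_ip[OF U[OF assms(3)] assms(4) that] .
  show "\<nu> g (v - w) = \<nu> g v - \<nu> g w" if "w \<in> l2 I"
    using lin[OF that assms(4), of "-1"] by (simp add: fun_diff_def)
qed

text \<open>A line that almost maximises its worst overlap with the orbit of \<open>\<xi>\<close> is almost invariant:
  its translates are almost maximisers too, and two almost maximisers at a definite distance
  would have a better midpoint.\<close>

lemma almost_invariant_line:
  fixes G (structure)
  assumes G: "group G" and H: "subgroup H G" and \<nu>: "unitary_hom G I \<nu>"
    and \<xi>: "\<xi> \<in> l2 I" "l2norm I \<xi> = 1"
    and close: "\<And>h. h \<in> H \<Longrightarrow> 7/8 \<le> cmod (l2ip I (\<nu> h \<xi>) \<xi>)" and "\<tau> > 0"
  obtains \<eta> where "\<eta> \<in> l2 I" "l2norm I \<eta> = 1" "3/4 \<le> cmod (l2ip I \<xi> \<eta>)"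
    "\<And>h. h \<in> H \<Longrightarrow> \<exists>c. cmod c = 1 \<and> l2norm I (\<nu> h \<eta> - (\<lambda>i. c * \<eta> i)) \<le> \<tau>"
proof -
  interpret group G by fact
  interpret H: subgroup H G by fact
  note hom = unitary_homD[OF \<nu> G]
  define V where "V \<eta> = (INF h\<in>H. (cmod (l2ip I (\<nu> h \<xi>) \<eta>))\<^sup>2)" for \<eta>
  define B where "B = {\<eta> \<in> l2 I. l2norm I \<eta> = 1}"
  define s where "s = (SUP \<eta>\<in>B. V \<eta>)"
  \<comment> \<open>As \<open>s\<close> is at least 49/64, the bound 1/64 leaves an overlap of at
    least 3/4 with \<open>\<xi>\<close>. The bound by \<open>\<tau>\<close> makes the final
    displacement at most \<open>\<tau>\<close>.\<close>
  define \<sigma> where "\<sigma> = min (1/64) (\<tau>\<^sup>2 / 8)"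
  have orb: "\<nu> h \<xi> \<in> l2 I" "l2norm I (\<nu> h \<xi>) = 1" if "h \<in> H" for h
    using that \<xi> by (simp_all add: hom)
  have V_le: "V \<eta> \<le> (cmod (l2ip I (\<nu> h \<xi>) \<eta>))\<^sup>2" if "h \<in> H" for h \<eta>
    unfolding V_def using that by (intro cINF_lower bdd_belowI2[of _ 0]) auto
  have V_ge: "r \<le> V \<eta>" if "\<And>h. h \<in> H \<Longrightarrow> r \<le> (cmod (l2ip I (\<nu> h \<xi>) \<eta>))\<^sup>2" for r \<eta>
    unfolding V_def by (rule cINF_greatest[OF _ that]) (use H.one_closed in blast)+
  have V1: "V \<eta> \<le> 1" if "\<eta> \<in> B" for \<eta>
  proof -
    have "cmod (l2ip I (\<nu> \<one> \<xi>) \<eta>) \<le> 1"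
      using l2_Cauchy_Schwarz[OF orb(1)[OF H.one_closed], of \<eta>] orb(2)[OF H.one_closed] that
      by (simp add: B_def)
    then have "(cmod (l2ip I (\<nu> \<one> \<xi>) \<eta>))\<^sup>2 \<le> 1" by (simp add: power_le_one)
    then show ?thesis using V_le[of \<one> \<eta>] by simp
  qed
  have V_s: "V \<eta> \<le> s" if "\<eta> \<in> B" for \<eta>
    unfolding s_def using that V1 by (intro cSUP_upper bdd_aboveI2) auto
  have \<xi>B: "\<xi> \<in> B" using \<xi> by (simp add: B_def)
  have "(7/8)\<^sup>2 \<le> V \<xi>"
    by (rule V_ge) (rule power_mono[OF close], simp_all)
  then have s: "49/64 \<le> s" using V_s[OF \<xi>B] by (simp add: power2_eq_square)
  have \<sigma>: "\<sigma> > 0" "\<sigma> \<le> 1/64" "8 * \<sigma> \<le> \<tau>\<^sup>2" using \<open>\<tau> > 0\<close> by (auto simp: \<sigma>_def min_def)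
  have "s - \<sigma> < (SUP \<eta>\<in>B. V \<eta>)" using \<sigma> by (simp add: s_def)
  then obtain \<eta> where \<eta>B: "\<eta> \<in> B" and V\<eta>: "s - \<sigma> < V \<eta>"
    by (subst (asm) less_cSUP_iff) (use \<xi>B V1 in \<open>auto intro!: bdd_aboveI2[of _ _ 1]\<close>)
  then have \<eta>: "\<eta> \<in> l2 I" "l2norm I \<eta> = 1" by (auto simp: B_def)
  have "(3/4)\<^sup>2 \<le> (cmod (l2ip I \<xi> \<eta>))\<^sup>2"
    using V_le[OF H.one_closed, of \<eta>] V\<eta> s \<sigma>
    by (simp add: hom(4)[OF one_closed \<xi>(1)] power2_eq_square)
  then have far: "3/4 \<le> cmod (l2ip I \<xi> \<eta>)" by (rule power2_le_imp_le) simp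
  have "\<exists>c. cmod c = 1 \<and> l2norm I (\<nu> h \<eta> - (\<lambda>i. c * \<eta> i)) \<le> \<tau>" if h: "h \<in> H" for h
  proof -
    have hG: "h \<in> carrier G" using h by simp
    define p where "p = l2ip I \<eta> (\<nu> h \<eta>)"
    define t where "t = cmod p"
    \<comment> \<open>This phase rotates \<open>\<nu> h \<eta>\<close> within its line until its
      inner product with \<open>\<eta>\<close> is the nonnegative real \<open>t\<close>, as the
      midpoint lemma requires.\<close>
    define \<omega> where "\<omega> = (if p = 0 then 1 else sgn p)"
    have \<omega>1: "cmod \<omega> = 1" by (simp add: \<omega>_def norm_sgn)
    have \<omega>p: "cnj \<omega> * p = of_real t"
    proof (cases "p = 0")
      case False
      have "cnj p * p = of_real t * of_real t"
        using complex_norm_square[of p] by (simp add: t_def power2_eq_square mult.commute)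
      then show ?thesis using False by (simp add: \<omega>_def sgn_eq t_def)
    qed (simp add: t_def)
    have y: "\<nu> h \<eta> \<in> l2 I" "l2norm I (\<nu> h \<eta>) = 1" using hG \<eta> by (simp_all add: hom)
    define y' where "y' = (\<lambda>i. \<omega> * \<nu> h \<eta> i)"
    have y': "y' \<in> l2 I" "l2norm I y' = 1"
      unfolding y'_def using y \<omega>1 by (simp_all add: l2_scale l2norm_scale)
    have "l2ip I \<eta> y' = of_real t"
      unfolding y'_def using l2ip_scale_right[OF y(1) \<eta>(1), of \<omega>] \<omega>p by (simp add: p_def)
    then obtain u where u: "u \<in> l2 I" "l2norm I u = 1"
      and mid: "\<And>z. z \<in> l2 I \<Longrightarrow> l2norm I z = 1 \<Longrightarrow>
        (cmod (l2ip I z \<eta>))\<^sup>2 + (cmod (l2ip I z y'))\<^sup>2 \<le> 2 * t * (cmod (l2ip I z u))\<^sup>2 + (1 - t)"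
      using projective_midpoint[OF \<eta> y'] by (metis t_def norm_ge_zero)
    \<comment> \<open>The orbit of \<open>\<xi>\<close> is invariant under \<open>h\<close>, so the
      translate \<open>\<nu> h \<eta>\<close> has worst overlap no smaller than
      \<open>V \<eta>\<close>.\<close>
    have mid': "2 * V \<eta> \<le> 2 * t * (cmod (l2ip I (\<nu> k \<xi>) u))\<^sup>2 + (1 - t)" if k: "k \<in> H" for k
    proof -
      have hk: "inv h \<otimes> k \<in> H" using h k by simp
      have "h \<otimes> (inv h \<otimes> k) = k" using h k by (simp add: m_assoc[symmetric])
      then have "\<nu> k \<xi> = \<nu> h (\<nu> (inv h \<otimes> k) \<xi>)"
        using hom(3)[OF hG \<xi>(1), of "inv h \<otimes> k"] hk by simp
      then have "l2ip I (\<nu> k \<xi>) (\<nu> h \<eta>) = l2ip I (\<nu> (inv h \<otimes> k) \<xi>) \<eta>"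
        using hom(6)[OF hG orb(1)[OF hk] \<eta>(1)] by simp
      moreover have "cmod (l2ip I (\<nu> k \<xi>) y') = cmod (l2ip I (\<nu> k \<xi>) (\<nu> h \<eta>))"
        unfolding y'_def using l2ip_scale_right[OF y(1) orb(1)[OF k]] by (simp add: norm_mult \<omega>1)
      ultimately show ?thesis
        using V_le[OF k, of \<eta>] V_le[OF hk, of \<eta>] mid[OF orb[OF k]] by simp
    qed
    have main: "2 * V \<eta> \<le> 2 * t * s + (1 - t)"
    proof (cases "t = 0")
      case True
      then show ?thesis using mid'[OF H.one_closed] by simp
    next
      case False
      then have t: "t > 0" by (simp add: t_def)
      have "(2 * V \<eta> - (1 - t)) / (2 * t) \<le> V u"
        by (rule V_ge) (use mid' t in \<open>simp add: field_simps\<close>)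
      also have "\<dots> \<le> s" by (rule V_s) (simp add: B_def u)
      finally show ?thesis using t by (simp add: field_simps)
    qed
    have t1: "t \<le> 1" using l2_Cauchy_Schwarz[OF \<eta>(1) y(1)] by (simp add: t_def p_def \<eta> y)
    \<comment> \<open>Strict convexity enters through \<open>s\<close> being bounded away from 1/2:
      near-maximality of \<open>\<eta>\<close> then forces \<open>t\<close> close to 1.\<close>
    have "1/2 * (1 - t) \<le> (2 * s - 1) * (1 - t)"
      using s t1 by (intro mult_right_mono) auto
    also have "\<dots> \<le> 2 * \<sigma>" using main V\<eta> by (simp add: algebra_simps)
    finally have t4: "1 - t \<le> 4 * \<sigma>" by simp
    have "(l2norm I (\<lambda>i. (- cnj \<omega>) * \<eta> i + \<nu> h \<eta> i))\<^sup>2 = 2 - 2 * t"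
      using \<omega>p by (subst l2norm_lincomb_sq[OF \<eta>(1) y(1)]) (simp add: \<omega>1 \<eta> y p_def[symmetric] del: minus_mult_left)
    also have "\<dots> \<le> \<tau>\<^sup>2" using t4 \<sigma> by simp
    finally have "l2norm I (\<lambda>i. (- cnj \<omega>) * \<eta> i + \<nu> h \<eta> i) \<le> \<tau>"
      by (rule power2_le_imp_le) (use \<open>\<tau> > 0\<close> in simp)
    then show ?thesis
      by (intro exI[of _ "cnj \<omega>"]) (simp add: \<omega>1 fun_diff_def)
  qed
  with \<eta> far show ?thesis by (rule that)
qed

text \<open>The errors simply add, because \<open>\<nu> g\<close> is isometric and \<open>d\<close>
  has modulus one.\<close>

lemma approx_eigenvalue_mult:
  fixes G (structure)
  assumes G: "group G" and \<nu>: "unitary_hom G I \<nu>" and \<eta>: "\<eta> \<in> l2 I"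
    and g: "g \<in> carrier G" "l2norm I (\<nu> g \<eta> - (\<lambda>i. c * \<eta> i)) \<le> \<alpha>"
    and k: "k \<in> carrier G" "l2norm I (\<nu> k \<eta> - (\<lambda>i. d * \<eta> i)) \<le> \<beta>" "cmod d = 1"
  shows "l2norm I (\<nu> (g \<otimes> k) \<eta> - (\<lambda>i. (c * d) * \<eta> i)) \<le> \<alpha> + \<beta>"
proof -
  note hom = unitary_homD[OF \<nu> G]
  let ?c = "\<lambda>i. c * \<eta> i" and ?d = "\<lambda>i. d * \<eta> i"
  have l2: "?c \<in> l2 I" "?d \<in> l2 I" "\<nu> k \<eta> \<in> l2 I" "\<nu> g \<eta> \<in> l2 I" "\<nu> g (\<nu> k \<eta>) \<in> l2 I" "\<nu> g ?d \<in> l2 I"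
    "(\<lambda>i. (c * d) * \<eta> i) \<in> l2 I"
    using \<eta> g k by (auto intro!: hom l2_scale)
  have diff: "\<nu> g (\<nu> k \<eta> - ?d) = \<nu> g (\<nu> k \<eta>) - \<nu> g ?d"
    by (rule hom(7)[OF g(1) l2(3,2)])
  have "l2norm I (\<nu> g (\<nu> k \<eta>) - \<nu> g ?d) \<le> \<beta>"
    using hom(2)[OF g(1) l2_diff[OF l2(3,2)]] k(2) by (simp add: diff)
  moreover have "l2norm I (\<nu> g ?d - (\<lambda>i. (c * d) * \<eta> i)) \<le> \<alpha>"
  proof -
    have "\<nu> g ?d - (\<lambda>i. (c * d) * \<eta> i) = (\<lambda>i. d * (\<nu> g \<eta> - ?c) i)"
      using hom(5)[OF g(1) \<eta>, of d] by (simp add: fun_eq_iff algebra_simps)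
    then show ?thesis using l2norm_scale[OF l2_diff[OF l2(4,1)], of d] g(2) k(3) by simp
  qed
  ultimately show ?thesis
    using l2norm_diff_triangle[OF l2(5,6,7)] hom(3)[OF g(1) \<eta> k(1)] by simp
qed

lemma approx_eigenvalue_power:
  fixes G (structure)
  assumes G: "group G" and \<nu>: "unitary_hom G I \<nu>" and \<eta>: "\<eta> \<in> l2 I"
    and g: "g \<in> carrier G" "l2norm I (\<nu> g \<eta> - (\<lambda>i. c * \<eta> i)) \<le> \<alpha>" "cmod c = 1"
  shows "l2norm I (\<nu> (g [^] (n::nat)) \<eta> - (\<lambda>i. c ^ n * \<eta> i)) \<le> n * \<alpha>"
proof (induction n)
  case 0
  interpret group G by fact
  have "\<nu> \<one> \<eta> = \<eta>" using unitary_homD(4)[OF \<nu> G one_closed \<eta>] .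
  then show ?case by (simp add: fun_diff_def l2norm_zero)
next
  case (Suc n)
  interpret group G by fact
  show ?case
    using approx_eigenvalue_mult[OF G \<nu> \<eta> _ Suc g] g(1) by (simp add: fun_diff_def algebra_simps)
qed

text \<open>A unitary with different eigenvalues has orthogonal eigenvectors. Quantitatively,
  invariance of the inner product of \<open>\<xi>\<close> and \<open>\<eta>\<close> under
  \<open>\<nu> g\<close> nearly multiplies it by \<open>c * cnj d\<close>.\<close>

lemma approx_eigenvalue_close:
  fixes G (structure)
  assumes G: "group G" and \<nu>: "unitary_hom G I \<nu>" and g: "g \<in> carrier G"
    and \<xi>: "\<xi> \<in> l2 I" "l2norm I \<xi> = 1" and \<eta>: "\<eta> \<in> l2 I" "l2norm I \<eta> = 1"
    and c: "l2norm I (\<nu> g \<xi> - (\<lambda>i. c * \<xi> i)) \<le> \<alpha>" "cmod c = 1"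
    and d: "l2norm I (\<nu> g \<eta> - (\<lambda>i. d * \<eta> i)) \<le> \<beta>" "cmod d = 1"
  shows "cmod (c - d) * cmod (l2ip I \<xi> \<eta>) \<le> \<alpha> + \<beta>"
proof -
  note hom = unitary_homD[OF \<nu> G g]
  let ?x = "\<nu> g \<xi>" and ?y = "\<nu> g \<eta>" and ?cx = "\<lambda>i. c * \<xi> i" and ?dy = "\<lambda>i. d * \<eta> i"
  let ?p = "l2ip I \<xi> \<eta>"
  have l2: "?x \<in> l2 I" "?y \<in> l2 I" "?cx \<in> l2 I" "?dy \<in> l2 I"
    using \<xi> \<eta> by (auto intro!: hom l2_scale)
  have cd: "l2ip I ?cx ?dy = c * cnj d * ?p"
    using l2ip_scale_left[OF \<xi>(1) l2(4), of c] l2ip_scale_right[OF \<eta>(1) \<xi>(1), of d] by simp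
  have "?p - c * cnj d * ?p = l2ip I (?x - ?cx) ?y + l2ip I ?cx (?y - ?dy)"
    using hom(6)[OF \<xi>(1) \<eta>(1)] by (simp add: l2ip_diff_left l2ip_diff_right l2 cd)
  moreover have "cmod (l2ip I (?x - ?cx) ?y) \<le> \<alpha>"
    using l2_Cauchy_Schwarz[OF l2_diff[OF l2(1,3)] l2(2)] c(1) hom(2)[OF \<eta>(1)] \<eta>(2) by simp
  moreover have "cmod (l2ip I ?cx (?y - ?dy)) \<le> \<beta>"
    using l2_Cauchy_Schwarz[OF l2(3) l2_diff[OF l2(2,4)]] d(1) c(2) l2norm_scale[OF \<xi>(1), of c] \<xi>(2)
    by simp
  ultimately have "cmod (?p - c * cnj d * ?p) \<le> \<alpha> + \<beta>"
    using norm_triangle_ineq[of "l2ip I (?x - ?cx) ?y" "l2ip I ?cx (?y - ?dy)"] by simp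
  moreover have "d * (?p - c * cnj d * ?p) = (d - c) * ?p"
  proof -
    have "d * cnj d = 1" using complex_norm_square[of d] d(2) by simp
    then have "d * (c * cnj d * ?p) = c * ?p" by (metis mult.assoc mult.commute mult.right_neutral)
    then show ?thesis by (simp add: algebra_simps)
  qed
  then have "cmod (?p - c * cnj d * ?p) = cmod (c - d) * cmod ?p"
    using d(2) by (metis mult_1 norm_minus_commute norm_mult)
  ultimately show ?thesis by simp
qed

text \<open>While \<open>w\<close> is within 1/4 of 1, squaring expands its distance from 1 by the
  factor \<open>cmod (w + 1)\<close>, which is at least 7/4. A point surviving \<open>K\<close>
  squarings must have started very close to 1.\<close>

lemma near_one_of_powers_near_one:
  fixes z :: complex
  assumes "\<And>n. n \<le> 2 ^ K \<Longrightarrow> cmod (z ^ n - 1) \<le> 1/4"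
  shows "cmod (z - 1) \<le> (4/7) ^ K"
proof -
  have "(7/4) ^ k * cmod (z - 1) \<le> cmod (z ^ (2 ^ k) - 1)" if "k \<le> K" for k
    using that
  proof (induction k)
    case (Suc k)
    let ?w = "z ^ (2 ^ k)"
    have "cmod (?w - 1) \<le> 1/4" using Suc.prems by (intro assms) (simp add: power_increasing)
    then have "7/4 \<le> cmod (?w + 1)"
      using norm_triangle_ineq2[of "2" "1 - ?w"] by (simp add: norm_minus_commute add.commute)
    then have "cmod (?w - 1) * (7/4) \<le> cmod (?w - 1) * cmod (?w + 1)"
      by (rule mult_left_mono) simp
    also have "\<dots> = cmod (z ^ (2 ^ Suc k) - 1)"
    proof -
      have "z ^ (2 ^ Suc k) = ?w * ?w" by (simp add: mult_2 power_add)
      then show ?thesis unfolding norm_mult[symmetric] by (simp add: algebra_simps)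
    qed
    finally show ?case using Suc by simp
  qed simp
  from this[of K] assms[of "2 ^ K"] have "(7/4) ^ K * cmod (z - 1) \<le> 1" by simp
  then show ?thesis by (simp add: power_divide field_simps)
qed

section \<open>Distance to homomorphisms\<close>

lemma unitary_map_diff_le:
  assumes "unitary_map G I \<mu>" "unitary_map G I \<nu>" "g \<in> carrier G" "v \<in> l2 I" "l2norm I v \<le> 1"
  shows "l2norm I (\<mu> g v - \<nu> g v) \<le> 2"
proof -
  have "\<mu> g v \<in> l2 I" "\<nu> g v \<in> l2 I" "l2norm I (\<mu> g v) = l2norm I v" "l2norm I (\<nu> g v) = l2norm I v"
    using assms by (auto simp: unitary_map_def unitary_op_def)
  then show ?thesis using l2norm_diff_le[of "\<mu> g v" I "\<nu> g v"] assms(5) by simp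
qed

text \<open>The bound 2 for unitaries makes the supremum over the group finite, so it really
  dominates each individual displacement.\<close>

lemma
  assumes "group G" "unitary_map G I \<mu>" "unitary_map G I \<nu>"
  shows map_dist_le: "map_dist G I \<mu> \<nu> \<le> 2"
    and le_map_dist: "g \<in> carrier G \<Longrightarrow> v \<in> l2 I \<Longrightarrow> l2norm I v \<le> 1 \<Longrightarrow>
      l2norm I (\<mu> g v - \<nu> g v) \<le> map_dist G I \<mu> \<nu>"
proof -
  interpret group G by fact
  have op: "opnorm I (\<lambda>v. \<mu> g v - \<nu> g v) \<le> 2" if "g \<in> carrier G" for g
    by (rule opnorm_le) (use assms that in \<open>auto intro: unitary_map_diff_le\<close>)
  have "carrier G \<noteq> {}" by auto
  then show "map_dist G I \<mu> \<nu> \<le> 2"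
    unfolding map_dist_def by (rule cSUP_least) (rule op)
  show "l2norm I (\<mu> g v - \<nu> g v) \<le> map_dist G I \<mu> \<nu>"
    if g: "g \<in> carrier G" and v: "v \<in> l2 I" "l2norm I v \<le> 1"
  proof -
    have "l2norm I (\<mu> g v - \<nu> g v) \<le> opnorm I (\<lambda>v. \<mu> g v - \<nu> g v)"
      by (rule le_opnorm[OF _ v]) (rule unitary_map_diff_le[OF assms(2,3) g])
    also have "\<dots> \<le> map_dist G I \<mu> \<nu>"
      unfolding map_dist_def using op by (intro cSUP_upper[OF g] bdd_aboveI2)
    finally show ?thesis .
  qed
qed

lemma unitary_hom_trivial: "unitary_hom G I (\<lambda>g v. v)"
  by (auto simp: unitary_hom_def unitary_map_def unitary_op_def)

text \<open>Comparison with the trivial representation; the uniform bound keeps the supremum in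
  \<open>F_Ulam\<close> finite.\<close>

lemma dist_hom_le:
  assumes "group G" "unitary_map G I \<mu>"
  shows "dist_hom G I \<mu> \<le> 2"
proof -
  have "0 \<le> map_dist G I \<mu> \<nu>" if "unitary_hom G I \<nu>" for \<nu>
  proof -
    have "unitary_map G I \<nu>" using that by (simp add: unitary_hom_def)
    from le_map_dist[OF assms this group.is_monoid[OF assms(1), THEN monoid.one_closed] l2_zero]
    show ?thesis by (rule order_trans[OF l2norm_nonneg]) (simp add: l2norm_zero)
  qed
  then have "dist_hom G I \<mu> \<le> map_dist G I \<mu> (\<lambda>g v. v)"
    unfolding dist_hom_def by (intro cINF_lower bdd_belowI2) (auto simp: unitary_hom_trivial)
  also have "\<dots> \<le> 2"
    using map_dist_le[OF assms] unitary_hom_trivial unfolding unitary_hom_def by blast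
  finally show ?thesis .
qed

lemma cis_diff_le: "cmod (cis x - cis y) \<le> \<bar>x - y\<bar>"
proof -
  have "cis x - cis y = cis y * (cis (x - y) - 1)"
    by (simp add: right_diff_distrib cis_mult)
  then have "cmod (cis x - cis y) = 2 * \<bar>sin ((x - y) / 2)\<bar>"
    using dist_exp_i_1[of "x - y"] by (simp add: norm_mult cis_conv_exp)
  also have "\<dots> \<le> \<bar>x - y\<bar>" using abs_sin_x_le_abs_x[of "(x - y) / 2"] by simp
  finally show ?thesis .
qed

text \<open>On an almost invariant line \<open>\<nu>\<close> acts by approximate eigenvalues near
  \<open>\<theta>\<close>. Those of \<open>a\<close> and \<open>b\<close> are forced to 1 by their
  powers, so that of the \<open>M\<close>-th power of \<open>ab\<close> is near 1, against the value
  -1 of \<open>\<theta>\<close>.\<close>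

lemma almost_character_not_close:
  fixes G (structure)
  assumes G: "group G" and ab: "a \<in> carrier G" "b \<in> carrier G"
    and \<nu>: "unitary_hom G I \<nu>" and \<xi>: "\<xi> \<in> l2 I" "l2norm I \<xi> = 1"
    and \<theta>: "\<And>h. h \<in> generate G {a, b} \<Longrightarrow> cmod (\<theta> h) = 1"
      "\<And>n::nat. \<theta> (a [^] n) = 1" "\<And>n::nat. \<theta> (b [^] n) = 1" "\<theta> ((a \<otimes> b) [^] (M::nat)) = -1"
    and close: "\<And>h. h \<in> generate G {a, b} \<Longrightarrow> l2norm I (\<nu> h \<xi> - (\<lambda>i. \<theta> h * \<xi> i)) \<le> 1/8"
  shows False
proof -
  interpret group G by fact
  let ?H = "generate G {a, b}"
  have H: "subgroup ?H G" by (rule generate_is_subgroup) (use ab in simp)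
  interpret H: subgroup ?H G by fact
  have abH: "a \<in> ?H" "b \<in> ?H" by (auto intro: generate.incl)
  have pow_closed: "x [^] n \<in> ?H" if "x \<in> ?H" for x and n :: nat
    using that by (induction n) auto
  have ov: "7/8 \<le> cmod (l2ip I (\<nu> h \<xi>) \<xi>)" if h: "h \<in> ?H" for h
  proof -
    have x: "\<nu> h \<xi> \<in> l2 I" using unitary_homD(1)[OF \<nu> G _ \<xi>(1)] h by simp
    let ?t = "\<lambda>i. \<theta> h * \<xi> i"
    have t: "?t \<in> l2 I" by (rule l2_scale[OF \<xi>(1)])
    have "cmod (l2ip I (\<nu> h \<xi> - ?t) \<xi>) \<le> 1/8"
      using l2_Cauchy_Schwarz[OF l2_diff[OF x t] \<xi>(1)] close[OF h] \<xi>(2) by simp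
    moreover have "l2ip I (\<nu> h \<xi> - ?t) \<xi> = l2ip I (\<nu> h \<xi>) \<xi> - \<theta> h"
      using l2ip_scale_left[OF \<xi>(1) \<xi>(1), of "\<theta> h"] l2ip_self[OF \<xi>(1)]
      by (simp add: l2ip_diff_left x t \<xi>)
    ultimately show ?thesis
      using norm_triangle_ineq2[of "\<theta> h" "l2ip I (\<nu> h \<xi>) \<xi>"] \<theta>(1)[OF h]
      by (simp add: norm_minus_commute)
  qed
  \<comment> \<open>\<open>K\<close> squarings pin each letter's eigenvalue down so well that the
    \<open>M\<close>-th power of their product stays within 1 of 1.\<close>
  obtain K where K: "(4/7) ^ K * (2 * real M) \<le> 1"
  proof -
    obtain K where "(4/7) ^ K < 1 / (2 * real M + 1)"
      using real_arch_pow_inv[of "1 / (2 * real M + 1)" "4/7"] by auto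
    then have "(4/7) ^ K * (2 * real M + 1) \<le> 1" by (simp add: field_simps)
    moreover have "(4/7) ^ K * (2 * real M) \<le> (4/7) ^ K * (2 * real M + 1)"
      by (intro mult_left_mono) auto
    ultimately show ?thesis by (intro that[of K]) linarith
  qed
  \<comment> \<open>Errors accumulate over up to \<open>2 ^ K\<close> factors for powers of a
    letter, and \<open>2 * M\<close> factors for the power of \<open>ab\<close>; both totals stay
    below 1/16.\<close>
  define \<tau> :: real where "\<tau> = 1 / (16 * (2 ^ K + 2 * real M))"
  have pos: "0 < 2 ^ K + 2 * real M" by (simp add: add_pos_nonneg)
  then have \<tau>0: "\<tau> > 0" by (simp add: \<tau>_def)
  have \<tau>n: "n * \<tau> \<le> 1/16" if "n \<le> 2 ^ K + 2 * real M" for n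
    using that pos by (simp add: \<tau>_def field_simps)
  obtain \<eta> where \<eta>: "\<eta> \<in> l2 I" "l2norm I \<eta> = 1" and far: "3/4 \<le> cmod (l2ip I \<xi> \<eta>)"
    and eig: "\<And>h. h \<in> ?H \<Longrightarrow> \<exists>c. cmod c = 1 \<and> l2norm I (\<nu> h \<eta> - (\<lambda>i. c * \<eta> i)) \<le> \<tau>"
    using almost_invariant_line[OF G H \<nu> \<xi> ov \<tau>0] by blast
  \<comment> \<open>The combined error 1/8 + 1/16 is divided by the overlap 3/4 of
    \<open>\<xi>\<close> and \<open>\<eta>\<close>.\<close>
  have cmp: "cmod (\<theta> h - c) \<le> 1/4"
    if h: "h \<in> ?H" and c: "l2norm I (\<nu> h \<eta> - (\<lambda>i. c * \<eta> i)) \<le> 1/16" "cmod c = 1" for h c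
  proof -
    have "cmod (\<theta> h - c) * (3/4) \<le> cmod (\<theta> h - c) * cmod (l2ip I \<xi> \<eta>)"
      by (intro mult_left_mono far) simp
    also have "\<dots> \<le> 1/8 + 1/16"
      using approx_eigenvalue_close[OF G \<nu> _ \<xi> \<eta> close[OF h] \<theta>(1)[OF h] c] h by simp
    finally show ?thesis by simp
  qed
  have letter: "cmod (c - 1) \<le> (4/7) ^ K"
    if x: "x \<in> ?H" "\<And>n::nat. \<theta> (x [^] n) = 1"
      and c: "cmod c = 1" "l2norm I (\<nu> x \<eta> - (\<lambda>i. c * \<eta> i)) \<le> \<tau>" for x c
  proof (rule near_one_of_powers_near_one)
    fix n :: nat assume n: "n \<le> 2 ^ K"
    then have "real n \<le> 2 ^ K" using of_nat_le_iff[of n "2 ^ K", where 'a = real] by simp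
    then have "n * \<tau> \<le> 1/16" by (intro \<tau>n add_increasing2) auto
    then have "l2norm I (\<nu> (x [^] n) \<eta> - (\<lambda>i. c ^ n * \<eta> i)) \<le> 1/16"
      using approx_eigenvalue_power[OF G \<nu> \<eta>(1) _ c(2,1), of n] x by simp
    then have "cmod (\<theta> (x [^] n) - c ^ n) \<le> 1/4"
      by (intro cmp pow_closed x) (simp_all add: norm_power c)
    then show "cmod (c ^ n - 1) \<le> 1/4" by (simp add: x norm_minus_commute)
  qed
  obtain c where c: "cmod c = 1" "l2norm I (\<nu> a \<eta> - (\<lambda>i. c * \<eta> i)) \<le> \<tau>" using eig abH by blast
  obtain d where d: "cmod d = 1" "l2norm I (\<nu> b \<eta> - (\<lambda>i. d * \<eta> i)) \<le> \<tau>" using eig abH by blast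
  have "cmod (c * d - 1) \<le> cmod (d * (c - 1)) + cmod (d - 1)"
    using norm_triangle_ineq[of "d * (c - 1)" "d - 1"] by (simp add: algebra_simps)
  also have "\<dots> \<le> 2 * (4/7) ^ K"
    using letter[OF abH(1) \<theta>(2) c] letter[OF abH(2) \<theta>(3) d] by (simp add: norm_mult d)
  finally have cd: "cmod (c * d - 1) \<le> 2 * (4/7) ^ K" .
  have "cmod ((c * d) ^ M - 1 ^ M) \<le> M * cmod (c * d - 1)"
    by (rule norm_power_diff) (simp_all add: norm_mult c d)
  also have "\<dots> \<le> M * (2 * (4/7) ^ K)" by (intro mult_left_mono cd) simp
  finally have near: "cmod ((c * d) ^ M - 1) \<le> 1" using K by (simp add: algebra_simps)
  have "l2norm I (\<nu> (a \<otimes> b) \<eta> - (\<lambda>i. (c * d) * \<eta> i)) \<le> \<tau> + \<tau>"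
    by (rule approx_eigenvalue_mult[OF G \<nu> \<eta>(1) ab(1) c(2) ab(2) d(2,1)])
  then have "l2norm I (\<nu> ((a \<otimes> b) [^] M) \<eta> - (\<lambda>i. (c * d) ^ M * \<eta> i)) \<le> M * (\<tau> + \<tau>)"
    by (intro approx_eigenvalue_power[OF G \<nu> \<eta>(1)]) (simp_all add: ab norm_mult c d)
  also have "\<dots> \<le> 1/16" using \<tau>n[of "2 * real M"] by (simp add: algebra_simps)
  finally have "cmod (\<theta> ((a \<otimes> b) [^] M) - (c * d) ^ M) \<le> 1/4"
    by (intro cmp pow_closed) (use abH in \<open>simp_all add: norm_power norm_mult c d\<close>)
  then have "cmod (- 1 - (c * d) ^ M) \<le> 1/4" by (simp add: \<theta>)
  \<comment> \<open>The left side is the distance 2 between -1 and 1.\<close>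
  with near have "cmod ((- 1 - (c * d) ^ M) + ((c * d) ^ M - 1)) \<le> 1/4 + 1"
    by (intro norm_triangle_mono)
  then show False by simp
qed

section \<open>Maps of small defect far from every homomorphism\<close>

lemma exists_far_almost_hom:
  fixes G :: "('g, 'b) monoid_scheme" and j :: "'g \<Rightarrow> 'i"
  assumes "group G" "has_nonabelian_free_subgroup G" "inj j" "\<delta> > 0"
  obtains I :: "'i set" and \<mu> where "unitary_map G I \<mu>" "\<And>v. v \<in> l2 I \<Longrightarrow> \<mu> \<one>\<^bsub>G\<^esub> v = v"
    "defect G I \<mu> \<le> \<delta>" "1/8 \<le> dist_hom G I \<mu>"
proof -
  interpret group G by fact
  obtain a b where "a \<noteq> b" and fb: "free_basis G {a, b}"
    using free_basis_pair_of_nonabelian[OF assms(2)] by blast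
  then have ab: "a \<in> carrier G" "b \<in> carrier G" by (auto simp: free_basis_def)
  let ?H = "generate G {a, b}"
  have H: "subgroup ?H G" by (rule generate_is_subgroup) (use ab in simp)
  obtain \<phi> :: "'g \<Rightarrow> real" where
    \<phi>: "\<And>h k. h \<in> ?H \<Longrightarrow> k \<in> ?H \<Longrightarrow> \<bar>\<phi> (h \<otimes>\<^bsub>G\<^esub> k) - (\<phi> h + \<phi> k)\<bar> \<le> 3"
    "\<And>n :: nat. \<phi> (a [^]\<^bsub>G\<^esub> n) = 0" "\<And>n :: nat. \<phi> (b [^]\<^bsub>G\<^esub> n) = 0"
    "\<And>n :: nat. \<phi> ((a \<otimes>\<^bsub>G\<^esub> b) [^]\<^bsub>G\<^esub> n) = real n"
    using exists_quasimorphism[OF fb \<open>a \<noteq> b\<close>] by blast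
  \<comment> \<open>After scaling by \<open>pi / M\<close>, the error 3 of the quasimorphism becomes
    an angle below \<open>\<delta>\<close>, while the \<open>M\<close>-th power of \<open>ab\<close>
    gets the angle \<open>pi\<close>.\<close>
  obtain M :: nat where M: "3 * pi / \<delta> < M" using reals_Archimedean2 by blast
  have "0 < 3 * pi / \<delta>" using \<open>\<delta> > 0\<close> by simp
  then have M0: "real M > 0" using M by linarith
  define \<theta> where "\<theta> h = cis (pi / M * \<phi> h)" for h
  have \<theta>d: "cmod (\<theta> (h \<otimes>\<^bsub>G\<^esub> k) - \<theta> h * \<theta> k) \<le> \<delta>" if "h \<in> ?H" "k \<in> ?H" for h k
  proof -
    have "cmod (\<theta> (h \<otimes>\<^bsub>G\<^esub> k) - \<theta> h * \<theta> k)
        \<le> \<bar>pi / M * \<phi> (h \<otimes>\<^bsub>G\<^esub> k) - (pi / M * \<phi> h + pi / M * \<phi> k)\<bar>"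
      unfolding \<theta>_def cis_mult by (rule cis_diff_le)
    also have "\<dots> = pi / M * \<bar>\<phi> (h \<otimes>\<^bsub>G\<^esub> k) - (\<phi> h + \<phi> k)\<bar>"
      using M0 by (simp add: abs_mult right_diff_distrib[symmetric] distrib_left[symmetric] del: times_divide_eq_left)
    also have "\<dots> \<le> pi / M * 3" by (intro mult_left_mono \<phi> that) simp
    also have "\<dots> \<le> \<delta>" using M M0 \<open>\<delta> > 0\<close> by (simp add: field_simps)
    finally show ?thesis .
  qed
  have \<theta>1: "cmod (\<theta> h) = 1" for h by (simp add: \<theta>_def)
  have \<theta>0: "\<theta> \<one>\<^bsub>G\<^esub> = 1" using \<phi>(2)[of 0] by (simp add: \<theta>_def)
  obtain I :: "'i set" and \<mu> \<xi> where um: "unitary_map G I \<mu>" "\<And>v. v \<in> l2 I \<Longrightarrow> \<mu> \<one>\<^bsub>G\<^esub> v = v"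
      "defect G I \<mu> \<le> \<delta>"
    and \<xi>: "\<xi> \<in> l2 I" "l2norm I \<xi> = 1" and \<mu>\<xi>: "\<And>h. h \<in> ?H \<Longrightarrow> \<mu> h \<xi> = (\<lambda>i. \<theta> h * \<xi> i)"
    using induced_unitary_map[OF H assms(3) less_imp_le[OF \<open>\<delta> > 0\<close>] \<theta>1 \<theta>0 \<theta>d] by blast
  have "1/8 \<le> map_dist G I \<mu> \<nu>" if \<nu>: "unitary_hom G I \<nu>" for \<nu>
  proof (rule ccontr)
    assume less: "\<not> 1/8 \<le> map_dist G I \<mu> \<nu>"
    have um\<nu>: "unitary_map G I \<nu>" using \<nu> by (simp add: unitary_hom_def)
    have close: "l2norm I (\<nu> h \<xi> - (\<lambda>i. \<theta> h * \<xi> i)) \<le> 1/8" if h: "h \<in> ?H" for h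
    proof -
      have hG: "h \<in> carrier G" using h subgroup.subset[OF H] by auto
      have l2: "\<mu> h \<xi> \<in> l2 I" "\<nu> h \<xi> \<in> l2 I"
        using um(1) um\<nu> hG \<xi>(1) by (auto simp: unitary_map_def unitary_op_def)
      have "l2norm I (\<nu> h \<xi> - \<mu> h \<xi>) = l2norm I (\<mu> h \<xi> - \<nu> h \<xi>)"
        using l2norm_scale[OF l2_diff[OF l2], of "-1"] by (simp add: fun_diff_def)
      then show ?thesis
        using le_map_dist[OF assms(1) um(1) um\<nu> hG \<xi>(1)] \<xi>(2) less \<mu>\<xi>[OF h] by simp
    qed
    show False
      by (rule almost_character_not_close[OF assms(1) ab \<nu> \<xi> \<theta>1 _ _ _ close, where M = M])
        (use M0 in \<open>simp_all add: \<theta>_def \<phi>\<close>)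
  qed
  then have "1/8 \<le> dist_hom G I \<mu>"
    unfolding dist_hom_def using unitary_hom_trivial by (intro cINF_greatest) auto
  with um show ?thesis by (rule that)
qed

theorem theorem0p2:
  fixes G :: "('g, 'b) monoid_scheme"
  assumes "group G"
    and "has_nonabelian_free_subgroup G"
    and "\<exists>f :: 'g \<times> nat \<Rightarrow> 'i. inj f"
  shows "\<not> strongly_Ulam_stable G TYPE('i) \<and>
         (\<forall>\<delta>>0. F_Ulam G TYPE('i) \<delta> \<ge> sqrt 3 / 16)"
proof -
  obtain f :: "'g \<times> nat \<Rightarrow> 'i" where "inj f" using assms(3) by blast
  then have j: "inj (\<lambda>g. f (g, 0))" by (auto simp: inj_def)
  let ?F = "F_Ulam G TYPE('i)"
  define A where "A \<delta> = {(I :: 'i set, \<mu>). unitary_map G I \<mu> \<and>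
        (\<forall>v\<in>l2 I. \<mu> \<one>\<^bsub>G\<^esub> v = v) \<and> defect G I \<mu> \<le> \<delta>}" for \<delta>
  define D where "D p = dist_hom G (fst p) (snd p)"
    for p :: "'i set \<times> ('g \<Rightarrow> ('i \<Rightarrow> complex) \<Rightarrow> ('i \<Rightarrow> complex))"
  have F: "?F \<delta> = (SUP p\<in>A \<delta>. D p)" for \<delta>
    by (simp add: F_Ulam_def A_def D_def)
  have bdd: "bdd_above (D ` A \<delta>)" for \<delta>
    by (rule bdd_aboveI2[of _ _ 2]) (auto simp: A_def D_def intro: dist_hom_le[OF assms(1)])
  have far: "\<exists>p\<in>A \<delta>. 1/8 \<le> D p" if \<delta>: "\<delta> > 0" for \<delta>
  proof -
    obtain I :: "'i set" and \<mu> where "unitary_map G I \<mu>" "\<And>v. v \<in> l2 I \<Longrightarrow> \<mu> \<one>\<^bsub>G\<^esub> v = v"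
        "defect G I \<mu> \<le> \<delta>" "1/8 \<le> dist_hom G I \<mu>"
      using exists_far_almost_hom[OF assms(1,2) j \<delta>] by blast
    then show ?thesis by (intro bexI[of _ "(I, \<mu>)"]) (auto simp: A_def D_def)
  qed
  have low: "1/8 \<le> ?F \<delta>" if "\<delta> > 0" for \<delta>
    using far[OF that] cSUP_upper2[OF bdd] unfolding F by blast
  have mono: "?F \<delta> \<le> ?F \<epsilon>" if "0 < \<delta>" "\<delta> \<le> \<epsilon>" for \<delta> \<epsilon>
    unfolding F using far[OF that(1)] that(2) by (intro cSUP_subset_mono bdd) (auto simp: A_def)
  \<comment> \<open>\<open>Lim\<close> is informative only if the limit exists. Monotonicity and the
    lower bound 1/8 ensure this and identify the limit with the infimum.\<close>
  have lim: "(?F \<longlongrightarrow> Inf (?F ` ({0<..} \<inter> UNIV))) (at 0 within ({0<..} \<inter> UNIV))"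
    by (rule Lim_right_bound[where K = "1/8"]) (auto intro: mono low simp del: divide_le_eq_numeral1)
  then have "def_group G TYPE('i) = Inf (?F ` {0<..})"
    unfolding def_group_def by (intro tendsto_Lim) auto
  moreover have "1/8 \<le> Inf (?F ` {0<..})"
    by (rule cInf_greatest) (auto intro: low simp del: divide_le_eq_numeral1)
  ultimately have "\<not> strongly_Ulam_stable G TYPE('i)"
    by (simp add: strongly_Ulam_stable_def)
  \<comment> \<open>The bound 1/8 equals \<open>sqrt 4 / 16\<close>, slightly more than
    claimed.\<close>
  moreover have "sqrt 3 / 16 \<le> (1/8 :: real)"
    using real_sqrt_le_mono[of 3 4] by simp
  ultimately show ?thesis using low by force
qed

end
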